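(* The functor $\Xi_{\mathcal{I}}\colon t\mathcal{I}_+\to i\mathcal{I}_+$ is an equivalence of categories, and it is surjective on objects.
   Context: Intervals. For $n\ge0$ let $[n]=\{0,\dots,n\}$ with its usual order. $\mathcal{I}_+$ is the category whose objects (intervals) are the $[n]$ with $n\ge 0$ and whose morphisms are the order-preserving maps preserving the least and the greatest elements; these are the endpoints of $[n]$ (they coincide for $[0]$). The category $i\mathcal{I}_+$, defined inductively. The object of height $0$ is the interval $[0]$; it is called trivial (with $\mathrm{Ob}[0]=[0]$), and it is the only object whose underlying interval is $[0]$. For $n\ge1$, an object $H$ of height $n$ consists of an interval $\mathrm{Ob}\,H$ and, for each $i\in\mathrm{Ob}\,H$, an object $H(i)$ of height strictly less than $n$, such that $H(i)$ is trivial if and only if $i$ is an endpoint of $\mathrm{Ob}\,H$. For every object $H$ there is a unique morphism $H\to[0]$. For $K$ nontrivial, a morphism $g\colon H\to K$ consists of an interval map $g\colon\mathrm{Ob}\,H\to\mathrm{Ob}\,K$ and, for every $i\in\mathrm{Ob}\,H$, a morphism $g(i)\colon H(i)\to K(g i)$ (so there is none if $H$ is trivial). Composition: $(g\circ f)$ has object map the composite and $(g\circ f)(i)=g(f i)\circ f(i)$. Trees. A tree $(A,p)$ is a sequence of sets $A_n$ ($n\ge0$) and maps $p_n\colon A_{n+1}\to A_n$ with $A_0$ a singleton $\{\ast\}$; a tree map $f\colon(A,p)\to(B,q)$ is a sequence of maps $f_n\colon A_n\to B_n$ with $q_nf_{n+1}=f_np_n$. The tree has degree $n$ if every composite $A_{n+m}\to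 A_n$ ($m\ge1$) of the maps $p$ is bijective, and finite degree if it has degree $n$ for some $n\in\mathbb{N}$. The category $t\mathcal{I}_+$. An object is a tree $(A,p)$ of finite degree with an interval $F_n(y)\in\mathcal{I}_+$ for each $y\in A_n$, $n\ge0$ (the labels), and bijections $\lambda_n\colon A_{n+1}\cong\{(y,\xi) : y\in A_n,\ \xi\in F_n(y)\}$ of the form $\lambda_n(x)=(p_n(x),\lambda_{n,x})$, which is cropped: for all $n$ and $x\in A_{n+1}$, $\lambda_{n,x}$ is the least or greatest element of $F_n(p_nx)$ if and only if $F_{n+1}(x)=[0]$. Objects of degree $0$ (equivalently $F_0(\ast)=[0]$) are called trivial. A morphism $(f,\alpha)\colon(A,p,F,\lambda)\to(B,q,G,\eta)$ is a tree map $f$ together with interval maps $\alpha_{n,x}\colon F_n(x)\to G_n(f_nx)$ for all $n$ and $x\in A_n$, such that $\eta_{n,f_{n+1}x}=\alpha_{n,p_nx}(\lambda_{n,x})$ for all $x\in A_{n+1}$. Composition: $(g,\beta)\circ(f,\alpha)=(gf,(\beta_{n,f_nx}\circ\alpha_{n,x}))$. For $x\in A_1$, the restriction $A(x)$ is the object of $t\mathcal{I}_+$ with $A(x)_m=\{y\in A_{m+1} : y\mapsto x\text{ under }A_{m+1}\to A_1\}$, with $p$, $F$, $\lambda$ restricted; a morphism $(f,\alpha)$ restricts to $f(x)\colon A(x)\to B(f_1x)$. The functor $\Xi_{\mathcal{I}}$. Trivial objects go to $[0]$. A nontrivial $(A,F)$ goes to $H$ with $\mathrm{Ob}\,H=F_0(\ast)$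 and $H(\lambda_{0,x})=\Xi_{\mathcal{I}}(A(x))$ for each $x\in A_1$. A morphism with trivial codomain goes to the unique morphism to $[0]$; any other $(f,\alpha)$ goes to the morphism $g$ with object map $\alpha_{0,\ast}\colon F_0(\ast)\to G_0(\ast)$ and $g(\lambda_{0,x})=\Xi_{\mathcal{I}}(f(x))$ for each $x\in A_1$. *)

theory Defs
  imports "HOL-Library.FuncSet" "HOL-Library.Infinite_Typeclass"
begin

section \<open>Categories, functors, equivalences\<close>

text \<open>
  Categories are given by hom-sets, which need not be disjoint: a morphism is always considered
  together with its domain and codomain, so composition and the action of a functor on morphisms
  take the objects concerned as arguments. Outside the objects and hom-sets the operations are
  not constrained.
\<close>

record ('o, 'm) category =
  Obj :: "'o set"
  Hom :: "'o \<Rightarrow> 'o \<Rightarrow> 'm set"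
  Ident :: "'o \<Rightarrow> 'm"
  Comp :: "'o \<Rightarrow> 'o \<Rightarrow> 'o \<Rightarrow> 'm \<Rightarrow> 'm \<Rightarrow> 'm"
    \<comment> \<open>\<open>Comp C a b c g f\<close> is the composite of \<open>f : a \<rightarrow> b\<close> followed by \<open>g : b \<rightarrow> c\<close>\<close>

definition is_category :: "('o, 'm) category \<Rightarrow> bool" where
  "is_category C \<longleftrightarrow>
     (\<forall>a\<in>Obj C. Ident C a \<in> Hom C a a) \<and>
     (\<forall>a\<in>Obj C. \<forall>b\<in>Obj C. \<forall>c\<in>Obj C. \<forall>f\<in>Hom C a b. \<forall>g\<in>Hom C b c.
        Comp C a b c g f \<in> Hom C a c) \<and>
     (\<forall>a\<in>Obj C. \<forall>b\<in>Obj C. \<forall>f\<in>Hom C a b.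
        Comp C a a b f (Ident C a) = f \<and> Comp C a b b (Ident C b) f = f) \<and>
     (\<forall>a\<in>Obj C. \<forall>b\<in>Obj C. \<forall>c\<in>Obj C. \<forall>d\<in>Obj C.
        \<forall>f\<in>Hom C a b. \<forall>g\<in>Hom C b c. \<forall>h\<in>Hom C c d.
        Comp C a b d (Comp C b c d h g) f = Comp C a c d h (Comp C a b c g f))"

record ('o, 'm, 'p, 'n) func =
  on_obj :: "'o \<Rightarrow> 'p"
  on_hom :: "'o \<Rightarrow> 'o \<Rightarrow> 'm \<Rightarrow> 'n"

definition is_functor ::
  "('o, 'm) category \<Rightarrow> ('p, 'n) category \<Rightarrow> ('o, 'm, 'p, 'n) func \<Rightarrow> bool" where
  "is_functor C D F \<longleftrightarrow>
     is_category C \<and> is_category D \<and>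
     (\<forall>a\<in>Obj C. on_obj F a \<in> Obj D) \<and>
     (\<forall>a\<in>Obj C. \<forall>b\<in>Obj C. \<forall>f\<in>Hom C a b.
        on_hom F a b f \<in> Hom D (on_obj F a) (on_obj F b)) \<and>
     (\<forall>a\<in>Obj C. on_hom F a a (Ident C a) = Ident D (on_obj F a)) \<and>
     (\<forall>a\<in>Obj C. \<forall>b\<in>Obj C. \<forall>c\<in>Obj C. \<forall>f\<in>Hom C a b. \<forall>g\<in>Hom C b c.
        on_hom F a c (Comp C a b c g f) =
        Comp D (on_obj F a) (on_obj F b) (on_obj F c) (on_hom F b c g) (on_hom F a b f))"

definition id_func :: "('o, 'm, 'o, 'm) func" where
  "id_func = \<lparr>on_obj = (\<lambda>a. a), on_hom = (\<lambda>a b f. f)\<rparr>"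

definition comp_func ::
  "('p, 'n, 'q, 'k) func \<Rightarrow> ('o, 'm, 'p, 'n) func \<Rightarrow> ('o, 'm, 'q, 'k) func" where
  "comp_func G F =
     \<lparr>on_obj = (\<lambda>a. on_obj G (on_obj F a)),
      on_hom = (\<lambda>a b f. on_hom G (on_obj F a) (on_obj F b) (on_hom F a b f))\<rparr>"

definition is_iso :: "('o, 'm) category \<Rightarrow> 'o \<Rightarrow> 'o \<Rightarrow> 'm \<Rightarrow> bool" where
  "is_iso C a b f \<longleftrightarrow> f \<in> Hom C a b \<and>
     (\<exists>g\<in>Hom C b a. Comp C a b a g f = Ident C a \<and> Comp C b a b f g = Ident C b)"

definition is_nat_iso ::
  "('o, 'm) category \<Rightarrow> ('p, 'n) category \<Rightarrow>
   ('o, 'm, 'p, 'n) func \<Rightarrow> ('o, 'm, 'p, 'n) func \<Rightarrow> ('o \<Rightarrow> 'n) \<Rightarrow> bool" where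
  "is_nat_iso C D F G \<eta> \<longleftrightarrow>
     (\<forall>a\<in>Obj C. is_iso D (on_obj F a) (on_obj G a) (\<eta> a)) \<and>
     (\<forall>a\<in>Obj C. \<forall>b\<in>Obj C. \<forall>f\<in>Hom C a b.
        Comp D (on_obj F a) (on_obj F b) (on_obj G b) (\<eta> b) (on_hom F a b f) =
        Comp D (on_obj F a) (on_obj G a) (on_obj G b) (on_hom G a b f) (\<eta> a))"

definition is_equivalence ::
  "('o, 'm) category \<Rightarrow> ('p, 'n) category \<Rightarrow> ('o, 'm, 'p, 'n) func \<Rightarrow> bool" where
  "is_equivalence C D F \<longleftrightarrow>
     is_functor C D F \<and>
     (\<exists>G \<eta> \<epsilon>. is_functor D C G \<and>
        is_nat_iso C C id_func (comp_func G F) \<eta> \<and>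
        is_nat_iso D D (comp_func F G) id_func \<epsilon>)"

definition surjective_on_objects ::
  "('o, 'm) category \<Rightarrow> ('p, 'n) category \<Rightarrow> ('o, 'm, 'p, 'n) func \<Rightarrow> bool" where
  "surjective_on_objects C D F \<longleftrightarrow> (\<forall>d\<in>Obj D. \<exists>c\<in>Obj C. on_obj F c = d)"


section \<open>Intervals\<close>

text \<open>
  The interval $[n]$ is represented by the number \<open>n\<close>. All maps between sets are total functions
  that take the value \<^term>\<open>undefined\<close> outside their domain, so that equality of maps is
  equality of functions.
\<close>

definition interval_map :: "nat \<Rightarrow> nat \<Rightarrow> (nat \<Rightarrow> nat) \<Rightarrow> bool" where
  "interval_map m n f \<longleftrightarrow>
     f \<in> {0..m} \<rightarrow>\<^sub>E {0..n} \<and> mono_on {0..m} f \<and> f 0 = 0 \<and> f m = n"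

abbreviation is_endpoint :: "nat \<Rightarrow> nat \<Rightarrow> bool" where
  "is_endpoint n i \<equiv> i = 0 \<or> i = n"


section \<open>The inductively defined category\<close>

text \<open>
  \<open>Triv\<close> is the object $[0]$, and \<open>Node n h\<close> is the object with underlying interval $[n]$ and
  components \<open>h i\<close> for \<open>i \<le> n\<close>. The condition \<open>n \<ge> 1\<close> below says that \<open>Triv\<close> is the only object
  with underlying interval $[0]$.
\<close>

datatype iobj = Triv | Node nat "nat \<Rightarrow> iobj"

inductive has_height :: "nat \<Rightarrow> iobj \<Rightarrow> bool" where
  Triv: "has_height 0 Triv"
| Node: "k \<ge> 1 \<Longrightarrow> n \<ge> 1 \<Longrightarrow> h \<in> extensional {0..n} \<Longrightarrow>
    (\<forall>i\<in>{0..n}. \<exists>j<k. has_height j (h i)) \<Longrightarrow>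
    (\<forall>i\<in>{0..n}. h i = Triv \<longleftrightarrow> is_endpoint n i) \<Longrightarrow>
    has_height k (Node n h)"

text \<open>\<open>To_Triv\<close> is the unique morphism from any object to $[0]$.\<close>

datatype imor = To_Triv | Mor "nat \<Rightarrow> nat" "nat \<Rightarrow> imor"

inductive is_imor :: "iobj \<Rightarrow> iobj \<Rightarrow> imor \<Rightarrow> bool" where
  To_Triv: "is_imor H Triv To_Triv"
| Mor: "interval_map n m g \<Longrightarrow> gc \<in> extensional {0..n} \<Longrightarrow>
    (\<forall>i\<in>{0..n}. is_imor (h i) (k (g i)) (gc i)) \<Longrightarrow>
    is_imor (Node n h) (Node m k) (Mor g gc)"

primrec i_id :: "iobj \<Rightarrow> imor" where
  "i_id Triv = To_Triv"
| "i_id (Node n h) = Mor (\<lambda>i\<in>{0..n}. i) (\<lambda>i\<in>{0..n}. i_id (h i))"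

text \<open>
  The first argument is the domain of \<open>f\<close>. In a composable pair, if the domain of \<open>f\<close> is trivial,
  so is the codomain of \<open>g\<close>; and if \<open>f\<close> is \<open>To_Triv\<close>, so is \<open>g\<close>.
\<close>

primrec i_comp :: "iobj \<Rightarrow> imor \<Rightarrow> imor \<Rightarrow> imor" where
  "i_comp Triv g f = To_Triv"
| "i_comp (Node n h) g f =
     (case (g, f) of
        (Mor g' gc, Mor f' fc) \<Rightarrow>
          Mor (compose {0..n} g' f') (\<lambda>i\<in>{0..n}. i_comp (h i) (gc (f' i)) (fc i))
      | _ \<Rightarrow> To_Triv)"

definition iI :: "(iobj, imor) category" where
  "iI = \<lparr>Obj = {H. \<exists>n. has_height n H}, Hom = (\<lambda>H K. {g. is_imor H K g}),
         Ident = i_id, Comp = (\<lambda>H K L g f. i_comp H g f)\<rparr>"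


section \<open>Trees\<close>

record 'a tree =
  lev :: "nat \<Rightarrow> 'a set"
  par :: "nat \<Rightarrow> 'a \<Rightarrow> 'a"

definition is_tree :: "('a, 'z) tree_scheme \<Rightarrow> bool" where
  "is_tree T \<longleftrightarrow> (\<exists>r. lev T 0 = {r}) \<and> (\<forall>n. par T n \<in> lev T (Suc n) \<rightarrow>\<^sub>E lev T n)"

definition tree_root :: "('a, 'z) tree_scheme \<Rightarrow> 'a" where
  "tree_root T = the_elem (lev T 0)"

text \<open>\<open>anc T n m\<close> is the composite $A_{n+m} \to A_n$ of the maps $p$.\<close>

primrec anc :: "('a, 'z) tree_scheme \<Rightarrow> nat \<Rightarrow> nat \<Rightarrow> 'a \<Rightarrow> 'a" where
  "anc T n 0 = (\<lambda>y. y)"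
| "anc T n (Suc m) = (\<lambda>y. anc T n m (par T (n + m) y))"

definition has_degree :: "('a, 'z) tree_scheme \<Rightarrow> nat \<Rightarrow> bool" where
  "has_degree T n \<longleftrightarrow> (\<forall>m\<ge>1. bij_betw (anc T n m) (lev T (n + m)) (lev T n))"

definition is_tree_map ::
  "('a, 'z) tree_scheme \<Rightarrow> ('a, 'z) tree_scheme \<Rightarrow> (nat \<Rightarrow> 'a \<Rightarrow> 'a) \<Rightarrow> bool" where
  "is_tree_map S T f \<longleftrightarrow>
     (\<forall>n. f n \<in> lev S n \<rightarrow>\<^sub>E lev T n) \<and>
     (\<forall>n. \<forall>x\<in>lev S (Suc n). par T n (f (Suc n) x) = f n (par S n x))"


section \<open>The category of labelled trees\<close>

text \<open>
  The label $F_n(y)$ is the interval $[k]$ with \<open>k = lab T n y\<close>, and \<open>pos T n x\<close> is the second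
  component $\lambda_{n,x}$ of $\lambda_n(x) = (p_n(x), \lambda_{n,x})$.
\<close>

record 'a ltree = "'a tree" +
  lab :: "nat \<Rightarrow> 'a \<Rightarrow> nat"
  pos :: "nat \<Rightarrow> 'a \<Rightarrow> nat"

definition cropped :: "'a ltree \<Rightarrow> bool" where
  "cropped T \<longleftrightarrow> (\<forall>n. \<forall>x\<in>lev T (Suc n).
     is_endpoint (lab T n (par T n x)) (pos T n x) \<longleftrightarrow> lab T (Suc n) x = 0)"

definition is_tobj :: "'a ltree \<Rightarrow> bool" where
  "is_tobj T \<longleftrightarrow>
     is_tree T \<and> (\<exists>n. has_degree T n) \<and>
     (\<forall>n. lab T n \<in> extensional (lev T n)) \<and>
     (\<forall>n. pos T n \<in> extensional (lev T (Suc n))) \<and>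
     (\<forall>n. bij_betw (\<lambda>x. (par T n x, pos T n x))
        (lev T (Suc n)) (SIGMA y:lev T n. {0..lab T n y})) \<and>
     cropped T"

definition t_trivial :: "'a ltree \<Rightarrow> bool" where
  "t_trivial T \<longleftrightarrow> has_degree T 0"

record 'a tmor =
  tmap :: "nat \<Rightarrow> 'a \<Rightarrow> 'a"
  lmap :: "nat \<Rightarrow> 'a \<Rightarrow> nat \<Rightarrow> nat"

definition is_tmor :: "'a ltree \<Rightarrow> 'a ltree \<Rightarrow> 'a tmor \<Rightarrow> bool" where
  "is_tmor S T f \<longleftrightarrow>
     is_tree_map S T (tmap f) \<and>
     (\<forall>n. lmap f n \<in> extensional (lev S n)) \<and>
     (\<forall>n. \<forall>x\<in>lev S n. interval_map (lab S n x) (lab T n (tmap f n x)) (lmap f n x)) \<and>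
     (\<forall>n. \<forall>x\<in>lev S (Suc n).
        pos T n (tmap f (Suc n) x) = lmap f n (par S n x) (pos S n x))"

definition t_id :: "'a ltree \<Rightarrow> 'a tmor" where
  "t_id S =
     \<lparr>tmap = (\<lambda>n. \<lambda>x\<in>lev S n. x),
      lmap = (\<lambda>n. \<lambda>x\<in>lev S n. \<lambda>i\<in>{0..lab S n x}. i)\<rparr>"

definition t_comp :: "'a ltree \<Rightarrow> 'a tmor \<Rightarrow> 'a tmor \<Rightarrow> 'a tmor" where
  "t_comp S g f =
     \<lparr>tmap = (\<lambda>n. compose (lev S n) (tmap g n) (tmap f n)),
      lmap = (\<lambda>n. \<lambda>x\<in>lev S n.
        compose {0..lab S n x} (lmap g n (tmap f n x)) (lmap f n x))\<rparr>"

definition tI :: "('a ltree, 'a tmor) category" where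
  "tI = \<lparr>Obj = {T. is_tobj T}, Hom = (\<lambda>S T. {f. is_tmor S T f}),
         Ident = t_id, Comp = (\<lambda>S T U g f. t_comp S g f)\<rparr>"

definition sublev :: "'a ltree \<Rightarrow> 'a \<Rightarrow> nat \<Rightarrow> 'a set" where
  "sublev T x m = {y \<in> lev T (Suc m). anc T (Suc 0) m y = x}"

definition restr :: "'a ltree \<Rightarrow> 'a \<Rightarrow> 'a ltree" where
  "restr T x =
     \<lparr>lev = sublev T x,
      par = (\<lambda>m. restrict (par T (Suc m)) (sublev T x (Suc m))),
      lab = (\<lambda>m. restrict (lab T (Suc m)) (sublev T x m)),
      pos = (\<lambda>m. restrict (pos T (Suc m)) (sublev T x (Suc m)))\<rparr>"

definition restr_mor :: "'a ltree \<Rightarrow> 'a tmor \<Rightarrow> 'a \<Rightarrow> 'a tmor" where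
  "restr_mor S f x =
     \<lparr>tmap = (\<lambda>m. restrict (tmap f (Suc m)) (sublev S x m)),
      lmap = (\<lambda>m. restrict (lmap f (Suc m)) (sublev S x m))\<rparr>"


section \<open>The functor\<close>

text \<open>\<open>child T i\<close> is the element \<open>x\<close> of level 1 with $\lambda_{0,x} = i$.\<close>

definition child :: "'a ltree \<Rightarrow> nat \<Rightarrow> 'a" where
  "child T i = inv_into (lev T 1) (pos T 0) i"

definition min_degree :: "'a ltree \<Rightarrow> nat" where
  "min_degree T = (LEAST n. has_degree T n)"

lemma anc_in_lev:
  assumes "is_tree T" "y \<in> lev T (n + m)"
  shows "anc T n m y \<in> lev T n"
  using assms(2)
proof (induction m arbitrary: y)
  case 0
  then show ?case by simp
next
  case (Suc m)
  have "par T (n + m) y \<in> lev T (n + m)"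
    using assms(1) Suc.prems by (auto simp: is_tree_def PiE_def Pi_def)
  then show ?case using Suc.IH by simp
qed

lemma anc_add: "anc T a (b + c) y = anc T a b (anc T (a + b) c y)"
  by (induction c arbitrary: y) (simp_all add: add.assoc)

lemma anc_restr:
  assumes "is_tree T" "y \<in> sublev T x (n + m)"
  shows "anc (restr T x) n m y = anc T (Suc n) m y"
  using assms(2)
proof (induction m arbitrary: y)
  case 0
  then show ?case by simp
next
  case (Suc m)
  have "par T (Suc (n + m)) y \<in> sublev T x (n + m)"
    using assms(1) Suc.prems by (auto simp: is_tree_def PiE_def Pi_def sublev_def)
  then show ?case using Suc by (simp add: restr_def)
qed

lemma has_degree_restr:
  assumes T: "is_tree T" and deg: "has_degree T (Suc k)"
  shows "has_degree (restr T x) k"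
  unfolding has_degree_def
proof (intro allI impI)
  fix m :: nat assume "1 \<le> m"
  then have bij: "bij_betw (anc T (Suc k) m) (lev T (Suc k + m)) (lev T (Suc k))"
    using deg unfolding has_degree_def by blast
  have split: "anc T (Suc 0) (k + m) y = anc T (Suc 0) k (anc T (Suc k) m y)" for y
    using anc_add[of T "Suc 0" k m y] by simp
  have "bij_betw (anc T (Suc k) m) (sublev T x (k + m)) (sublev T x k)"
  proof (rule bij_betw_subset[OF bij])
    show "sublev T x (k + m) \<subseteq> lev T (Suc k + m)"
      by (auto simp: sublev_def)
    show "anc T (Suc k) m ` sublev T x (k + m) = sublev T x k"
    proof
      show "anc T (Suc k) m ` sublev T x (k + m) \<subseteq> sublev T x k"
        using anc_in_lev[OF T, of _ "Suc k" m] by (auto simp: sublev_def split)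
      show "sublev T x k \<subseteq> anc T (Suc k) m ` sublev T x (k + m)"
      proof
        fix z assume z: "z \<in> sublev T x k"
        then obtain y where "y \<in> lev T (Suc k + m)" "z = anc T (Suc k) m y"
          using bij_betw_imp_surj_on[OF bij] by (auto simp: sublev_def)
        then show "z \<in> anc T (Suc k) m ` sublev T x (k + m)"
          using z by (auto simp: sublev_def split)
      qed
    qed
  qed
  then show "bij_betw (anc (restr T x) k m) (lev (restr T x) (k + m)) (lev (restr T x) k)"
    using bij_betw_cong[of "sublev T x (k + m)" "anc (restr T x) k m" "anc T (Suc k) m"]
    by (simp add: anc_restr[OF T]) (simp add: restr_def)
qed

lemma min_degree_restr:
  assumes T: "is_tobj T" and "\<not> t_trivial T"
  shows "min_degree (restr T x) < min_degree T"
proof -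
  have "has_degree T (min_degree T)"
    using T unfolding is_tobj_def min_degree_def by (metis LeastI)
  moreover from this obtain k where k: "min_degree T = Suc k"
    using assms(2) by (cases "min_degree T") (auto simp: t_trivial_def)
  ultimately have "has_degree (restr T x) k"
    using T has_degree_restr[of T k x] by (simp add: is_tobj_def)
  then have "min_degree (restr T x) \<le> k"
    unfolding min_degree_def by (rule Least_le)
  then show ?thesis using k by simp
qed

lemma restrict_fundef_cong [fundef_cong]:
  "A = B \<Longrightarrow> (\<And>i. i \<in> B \<Longrightarrow> f i = g i) \<Longrightarrow> restrict f A = restrict g B"
  by (auto simp: restrict_def)

text \<open>
  The two parts of the functor are total functions in the logic; the value \<^term>\<open>undefined\<close> is
  only reached outside the category.
\<close>

function Xi_obj :: "'a ltree \<Rightarrow> iobj" where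
  "Xi_obj T =
     (if \<not> is_tobj T then undefined
      else if t_trivial T then Triv
      else Node (lab T 0 (tree_root T))
             (\<lambda>i\<in>{0..lab T 0 (tree_root T)}. Xi_obj (restr T (child T i))))"
  by auto
termination
  by (relation "measure min_degree") (auto simp: min_degree_restr)

function Xi_mor :: "'a ltree \<Rightarrow> 'a ltree \<Rightarrow> 'a tmor \<Rightarrow> imor" where
  "Xi_mor S T f =
     (if \<not> (is_tobj S \<and> is_tobj T \<and> is_tmor S T f) then undefined
      else if t_trivial T then To_Triv
      else Mor (lmap f 0 (tree_root S))
             (\<lambda>i\<in>{0..lab S 0 (tree_root S)}.
                let x = child S i in
                Xi_mor (restr S x) (restr T (tmap f 1 x)) (restr_mor S f x)))"
  by auto
termination
  by (relation "measure (\<lambda>(S, T, f). min_degree T)") (auto simp: min_degree_restr)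

declare Xi_obj.simps [simp del] Xi_mor.simps [simp del]

definition Xi :: "('a ltree, 'a tmor, iobj, imor) func" where
  "Xi = \<lparr>on_obj = Xi_obj, on_hom = Xi_mor\<rparr>"

end

theory Submission
  imports Defs "HOL-Library.Countable"
begin

text \<open>
  Both categories carry the same recursive data. A nontrivial labelled tree is determined by the
  label of its root together with one restriction for each point of that label, and a morphism
  into a nontrivial tree is determined by its interval map at the root together with its
  restrictions; this is literally the shape in which objects and morphisms of \<open>iI\<close> are built. The
  functor only forgets how the nodes of the tree are named. Since the degree of a
  nontrivial tree drops under restriction, statements about trees and their morphisms can be proved
  by induction along restrictions (\<open>tobj_induct\<close>).

  Full faithfulness (\<open>Xi_fully_faithful\<close>): into a trivial tree there is exactly one morphism, as
  all of its levels are singletons and all of its labels are $[0]$. Into a nontrivial tree, a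
  morphism can be recovered from its root map and its restrictions, because every node above the
  root lies over exactly one node of level 1 (\<open>Xi_mor_inj\<close>); conversely any compatible choice of a
  root map and of restrictions can be put together to a morphism (\<open>graft\<close>, \<open>Xi_mor_surj\<close>).

  Surjectivity on objects (\<open>Xi_surjective_on_objects\<close>): the nodes of the tree belonging to an
  object \<open>H\<close> are the finite paths of positions that can be followed into \<open>H\<close>, named by elements of
  the type \<open>'a\<close> along an injection \<open>e\<close> from lists of numbers. Restricting this tree to the path
  \<open>[i]\<close> gives the tree of the component of \<open>H\<close> at \<open>i\<close>, with the naming \<open>e \<circ> Cons i\<close>
  (\<open>restr_path_tree\<close>). Hence the functor takes the tree of \<open>H\<close> to \<open>H\<close> itself, and not just to an
  isomorphic object (\<open>Xi_obj_path_tree\<close>).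

  A fully faithful functor that is surjective on objects is an equivalence (\<open>equivalenceI\<close>).
\<close>


section \<open>Fully faithful functors that are surjective on objects\<close>

text \<open>
  A section \<open>s\<close> of the functor on objects extends to a functor in the other direction, since every
  morphism between values of \<open>F\<close> has a unique lift. As \<open>F (s d) = d\<close>, one of the two natural
  isomorphisms consists of identities, and the other one of lifts of identities. All equations in
  the domain are checked after applying \<open>F\<close>.
\<close>

lemma equivalenceI:
  assumes F: "is_functor C D F"
    and bij: "\<And>a b. a \<in> Obj C \<Longrightarrow> b \<in> Obj C \<Longrightarrow>
      bij_betw (on_hom F a b) (Hom C a b) (Hom D (on_obj F a) (on_obj F b))"
    and surj: "surjective_on_objects C D F"
  shows "is_equivalence C D F"
proof -
  define s where "s d = (SOME c. c \<in> Obj C \<and> on_obj F c = d)" for d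
  define lift where "lift a b = inv_into (Hom C a b) (on_hom F a b)" for a b
  define G where "G = \<lparr>on_obj = s, on_hom = (\<lambda>d d'. lift (s d) (s d'))\<rparr>"
  define \<eta> where "\<eta> a = lift a (s (on_obj F a)) (Ident D (on_obj F a))" for a

  have C: "is_category C" and D: "is_category D"
    and F_obj: "\<And>a. a \<in> Obj C \<Longrightarrow> on_obj F a \<in> Obj D"
    and F_hom: "\<And>a b f. a \<in> Obj C \<Longrightarrow> b \<in> Obj C \<Longrightarrow> f \<in> Hom C a b \<Longrightarrow>
      on_hom F a b f \<in> Hom D (on_obj F a) (on_obj F b)"
    and F_id: "\<And>a. a \<in> Obj C \<Longrightarrow> on_hom F a a (Ident C a) = Ident D (on_obj F a)"
    and F_comp: "\<And>a b c f g. a \<in> Obj C \<Longrightarrow> b \<in> Obj C \<Longrightarrow> c \<in> Obj C \<Longrightarrow>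
      f \<in> Hom C a b \<Longrightarrow> g \<in> Hom C b c \<Longrightarrow> on_hom F a c (Comp C a b c g f) =
        Comp D (on_obj F a) (on_obj F b) (on_obj F c) (on_hom F b c g) (on_hom F a b f)"
    using F unfolding is_functor_def by blast+
  have C_id: "\<And>a. a \<in> Obj C \<Longrightarrow> Ident C a \<in> Hom C a a"
    and C_comp: "\<And>a b c f g. a \<in> Obj C \<Longrightarrow> b \<in> Obj C \<Longrightarrow> c \<in> Obj C \<Longrightarrow>
      f \<in> Hom C a b \<Longrightarrow> g \<in> Hom C b c \<Longrightarrow> Comp C a b c g f \<in> Hom C a c"
    using C unfolding is_category_def by blast+
  have D_id: "\<And>a. a \<in> Obj D \<Longrightarrow> Ident D a \<in> Hom D a a"
    and D_comp: "\<And>a b c f g. a \<in> Obj D \<Longrightarrow> b \<in> Obj D \<Longrightarrow> c \<in> Obj D \<Longrightarrow>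
      f \<in> Hom D a b \<Longrightarrow> g \<in> Hom D b c \<Longrightarrow> Comp D a b c g f \<in> Hom D a c"
    and D_idr: "\<And>a b f. a \<in> Obj D \<Longrightarrow> b \<in> Obj D \<Longrightarrow> f \<in> Hom D a b \<Longrightarrow>
      Comp D a a b f (Ident D a) = f"
    and D_idl: "\<And>a b f. a \<in> Obj D \<Longrightarrow> b \<in> Obj D \<Longrightarrow> f \<in> Hom D a b \<Longrightarrow>
      Comp D a b b (Ident D b) f = f"
    using D unfolding is_category_def by blast+

  have "s d \<in> Obj C \<and> on_obj F (s d) = d" if "d \<in> Obj D" for d
    unfolding s_def using surj that
    by (intro someI_ex[of "\<lambda>c. c \<in> Obj C \<and> on_obj F c = d"])
       (auto simp: surjective_on_objects_def)
  then have s_obj: "s d \<in> Obj C" and F_s: "on_obj F (s d) = d" if "d \<in> Obj D" for d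
    using that by auto
  have lift_hom: "lift a b g \<in> Hom C a b" and F_lift: "on_hom F a b (lift a b g) = g"
    if "a \<in> Obj C" "b \<in> Obj C" "g \<in> Hom D (on_obj F a) (on_obj F b)" for a b g
    using bij[OF that(1,2)] that(3)
    by (auto simp: lift_def bij_betw_def inv_into_into f_inv_into_f)
  have faithful: "f = f'"
    if "a \<in> Obj C" "b \<in> Obj C" "f \<in> Hom C a b" "f' \<in> Hom C a b"
      "on_hom F a b f = on_hom F a b f'" for a b f f'
    using bij[OF that(1,2)] that(3-5) by (auto simp: bij_betw_def dest: inj_onD)

  have G: "is_functor D C G"
    unfolding is_functor_def
  proof (intro conjI ballI D C)
    fix a assume a: "a \<in> Obj D"
    show "on_obj G a \<in> Obj C" using a by (simp add: G_def s_obj)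
    show "on_hom G a a (Ident D a) = Ident C (on_obj G a)"
      by (rule faithful[of "s a" "s a"])
        (use a in \<open>auto simp: G_def s_obj F_s lift_hom F_lift C_id D_id F_id\<close>)
  next
    fix a b f assume "a \<in> Obj D" "b \<in> Obj D" "f \<in> Hom D a b"
    then show "on_hom G a b f \<in> Hom C (on_obj G a) (on_obj G b)"
      by (simp add: G_def s_obj F_s lift_hom)
  next
    fix a b c f g
    assume "a \<in> Obj D" "b \<in> Obj D" "c \<in> Obj D" "f \<in> Hom D a b" "g \<in> Hom D b c"
    note * = this this(1-3)[THEN s_obj] this(1-3)[THEN F_s]
      D_comp[OF this(1-5)]
    show "on_hom G a c (Comp D a b c g f) =
      Comp C (on_obj G a) (on_obj G b) (on_obj G c) (on_hom G b c g) (on_hom G a b f)"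
    proof (rule faithful[of "s a" "s c"])
      show "on_hom F (s a) (s c) (on_hom G a c (Comp D a b c g f)) =
        on_hom F (s a) (s c)
          (Comp C (on_obj G a) (on_obj G b) (on_obj G c) (on_hom G b c g) (on_hom G a b f))"
        using * by (simp add: G_def F_comp lift_hom F_lift)
    qed (use * in \<open>simp_all add: G_def C_comp lift_hom\<close>)
  qed

  have \<eta>: "is_nat_iso C C id_func (comp_func G F) \<eta>"
    unfolding is_nat_iso_def is_iso_def id_func_def comp_func_def func.simps
  proof (intro conjI ballI)
    fix a assume a: "a \<in> Obj C"
    let ?b = "s (on_obj F a)"
    let ?\<theta> = "lift ?b a (Ident D (on_obj F a))"
    note * = a F_obj[OF a] s_obj[OF F_obj[OF a]] F_s[OF F_obj[OF a]] D_id[OF F_obj[OF a]]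
    have \<eta>: "\<eta> a \<in> Hom C a ?b" "on_hom F a ?b (\<eta> a) = Ident D (on_obj F a)"
      using * by (simp_all add: \<eta>_def lift_hom F_lift)
    have \<theta>: "?\<theta> \<in> Hom C ?b a" "on_hom F ?b a ?\<theta> = Ident D (on_obj F a)"
      using * by (simp_all add: lift_hom F_lift)
    show "\<eta> a \<in> Hom C a (on_obj G (on_obj F a))"
      using \<eta> by (simp add: G_def)
    have "Comp C a ?b a ?\<theta> (\<eta> a) = Ident C a"
      by (rule faithful[of a a]) (use * \<eta> \<theta> in \<open>simp_all add: C_comp C_id F_comp F_id D_idr\<close>)
    moreover have "Comp C ?b a ?b (\<eta> a) ?\<theta> = Ident C ?b"
      by (rule faithful[of ?b ?b]) (use * \<eta> \<theta> in \<open>simp_all add: C_comp C_id F_comp F_id D_idr\<close>)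
    ultimately show "\<exists>g\<in>Hom C (on_obj G (on_obj F a)) a.
        Comp C a (on_obj G (on_obj F a)) a g (\<eta> a) = Ident C a \<and>
        Comp C (on_obj G (on_obj F a)) a (on_obj G (on_obj F a)) (\<eta> a) g =
          Ident C (on_obj G (on_obj F a))"
      using \<theta>(1) by (auto simp: G_def)
  next
    fix a b f assume ab: "a \<in> Obj C" "b \<in> Obj C" and f: "f \<in> Hom C a b"
    let ?a = "s (on_obj F a)" and ?b = "s (on_obj F b)"
    let ?f = "lift ?a ?b (on_hom F a b f)"
    note * = ab f ab[THEN F_obj] ab[THEN F_obj, THEN s_obj] ab[THEN F_obj, THEN F_s]
      ab[THEN F_obj, THEN D_id] F_hom[OF ab f]
    have \<eta>a: "\<eta> a \<in> Hom C a ?a" "on_hom F a ?a (\<eta> a) = Ident D (on_obj F a)"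
      using * by (simp_all add: \<eta>_def lift_hom F_lift)
    have \<eta>b: "\<eta> b \<in> Hom C b ?b" "on_hom F b ?b (\<eta> b) = Ident D (on_obj F b)"
      using * by (simp_all add: \<eta>_def lift_hom F_lift)
    have f': "?f \<in> Hom C ?a ?b" "on_hom F ?a ?b ?f = on_hom F a b f"
      using * by (simp_all add: lift_hom F_lift)
    have "Comp C a b ?b (\<eta> b) f = Comp C a ?a ?b ?f (\<eta> a)"
      by (rule faithful[of a ?b])
        (use * \<eta>a \<eta>b f' in \<open>simp_all add: C_comp F_comp D_idr D_idl\<close>)
    then show "Comp C a b (on_obj G (on_obj F b)) (\<eta> b) f =
        Comp C a (on_obj G (on_obj F a)) (on_obj G (on_obj F b))
          (on_hom G (on_obj F a) (on_obj F b) (on_hom F a b f)) (\<eta> a)"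
      by (simp add: G_def)
  qed

  have "is_nat_iso D D (comp_func F G) id_func (Ident D)"
    unfolding is_nat_iso_def is_iso_def id_func_def comp_func_def func.simps
  proof (intro conjI ballI)
    fix a assume a: "a \<in> Obj D"
    then show "Ident D a \<in> Hom D (on_obj F (on_obj G a)) a"
      by (simp add: G_def F_s D_id)
    show "\<exists>g\<in>Hom D a (on_obj F (on_obj G a)).
        Comp D (on_obj F (on_obj G a)) a (on_obj F (on_obj G a)) g (Ident D a) =
          Ident D (on_obj F (on_obj G a)) \<and>
        Comp D a (on_obj F (on_obj G a)) a (Ident D a) g = Ident D a"
      using a by (intro bexI[of _ "Ident D a"]) (simp_all add: G_def F_s D_id D_idr)
  next
    fix a b f assume "a \<in> Obj D" "b \<in> Obj D" "f \<in> Hom D a b"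
    then show "Comp D (on_obj F (on_obj G a)) (on_obj F (on_obj G b)) b (Ident D b)
          (on_hom F (on_obj G a) (on_obj G b) (on_hom G a b f)) =
        Comp D (on_obj F (on_obj G a)) a b f (Ident D a)"
      by (simp add: G_def F_s s_obj F_lift D_idr D_idl)
  qed
  with F G \<eta> show ?thesis
    unfolding is_equivalence_def by blast
qed


section \<open>Interval maps\<close>

lemma interval_map_id: "interval_map n n (\<lambda>i\<in>{0..n}. i)"
  by (auto simp: interval_map_def mono_on_def)

lemma interval_map_compose:
  assumes "interval_map l m f" "interval_map m n g"
  shows "interval_map l n (compose {0..l} g f)"
  using assms by (auto simp: interval_map_def mono_on_def compose_def PiE_iff)

lemma interval_map_in: "interval_map m n f \<Longrightarrow> i \<le> m \<Longrightarrow> f i \<le> n"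
  by (auto simp: interval_map_def PiE_iff)

lemma interval_map_compose_id:
  assumes "interval_map m n f"
  shows "compose {0..m} f (\<lambda>i\<in>{0..m}. i) = f" "compose {0..m} (\<lambda>i\<in>{0..n}. i) f = f"
proof -
  have "f \<in> {0..m} \<rightarrow> {0..n}" "f \<in> extensional {0..m}"
    using assms by (simp_all add: interval_map_def PiE_iff)
  then show "compose {0..m} f (\<lambda>i\<in>{0..m}. i) = f" "compose {0..m} (\<lambda>i\<in>{0..n}. i) f = f"
    by (rule compose_Id, rule Id_compose)
qed

lemma no_interval_map_0: "interval_map 0 n f \<Longrightarrow> n = 0"
  by (auto simp: interval_map_def)

lemma interval_map_to_0: "interval_map m 0 f \<longleftrightarrow> f = (\<lambda>i\<in>{0..m}. 0)"
  by (auto simp: interval_map_def mono_on_def PiE_iff extensional_def fun_eq_iff)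


section \<open>The inductively defined category\<close>

abbreviation iobject :: "iobj \<Rightarrow> bool" where
  "iobject H \<equiv> \<exists>k. has_height k H"

lemma iobject_Triv [simp]: "iobject Triv"
  by (auto intro: has_height.Triv)

text \<open>
  Being an object can be tested componentwise: as there are only finitely many components, one plus
  the maximum of their heights bounds the height.
\<close>

lemma iobject_Node:
  "iobject (Node n h) \<longleftrightarrow> n \<ge> 1 \<and> h \<in> extensional {0..n} \<and>
     (\<forall>i\<le>n. iobject (h i)) \<and> (\<forall>i\<le>n. h i = Triv \<longleftrightarrow> is_endpoint n i)"
  (is "?L \<longleftrightarrow> ?R")
proof
  assume ?L
  then obtain k where "has_height k (Node n h)" by blast
  then show ?R by cases auto
next
  assume R: ?R
  then obtain ht where ht: "\<And>i. i \<le> n \<Longrightarrow> has_height (ht i) (h i)" by metis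
  have "has_height (Suc (Max (ht ` {0..n}))) (Node n h)"
  proof (rule has_height.Node)
    show "\<forall>i\<in>{0..n}. \<exists>j<Suc (Max (ht ` {0..n})). has_height j (h i)"
      using ht by (intro ballI exI[of _ "ht _"]) (auto simp: less_Suc_eq_le)
  qed (use R in auto)
  then show ?L by blast
qed

lemma is_imor_To_Triv_iff: "is_imor H Triv g \<longleftrightarrow> g = To_Triv"
  by (auto elim: is_imor.cases intro: is_imor.To_Triv)

lemma is_imor_from_Triv: "is_imor Triv K g \<Longrightarrow> K = Triv"
  by (auto elim: is_imor.cases)

lemma is_imor_Node:
  "is_imor (Node n h) (Node m k) g \<longleftrightarrow>
     (\<exists>\<alpha> gc. g = Mor \<alpha> gc \<and> interval_map n m \<alpha> \<and> gc \<in> extensional {0..n} \<and>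
       (\<forall>i\<le>n. is_imor (h i) (k (\<alpha> i)) (gc i)))"
  by (auto elim: is_imor.cases intro!: is_imor.Mor)

lemma i_comp_To_Triv: "i_comp H To_Triv f = To_Triv"
  by (cases H) auto

lemma is_imor_i_id: "is_imor H H (i_id H)"
  by (induction H) (auto simp: is_imor_To_Triv_iff is_imor_Node interval_map_id)

lemma is_imor_i_comp:
  "is_imor H K f \<Longrightarrow> is_imor K L g \<Longrightarrow> is_imor H L (i_comp H g f)"
proof (induction H arbitrary: K L f g)
  case Triv
  then show ?case
    using is_imor_from_Triv[OF Triv(1)] is_imor_from_Triv[of L g]
    by (auto simp: is_imor_To_Triv_iff)
next
  case (Node n h)
  show ?case
  proof (cases L)
    case Triv
    then show ?thesis using Node.prems by (simp add: is_imor_To_Triv_iff i_comp_To_Triv)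
  next
    case L: (Node l hl)
    then obtain m hk where K: "K = Node m hk"
      using Node.prems(2) is_imor_from_Triv by (cases K) auto
    obtain \<alpha> fc where f: "f = Mor \<alpha> fc" "interval_map n m \<alpha>"
      "\<And>i. i \<le> n \<Longrightarrow> is_imor (h i) (hk (\<alpha> i)) (fc i)"
      using Node.prems(1) by (auto simp: K is_imor_Node)
    obtain \<beta> gc where g: "g = Mor \<beta> gc" "interval_map m l \<beta>"
      "\<And>i. i \<le> m \<Longrightarrow> is_imor (hk i) (hl (\<beta> i)) (gc i)"
      using Node.prems(2) by (auto simp: K L is_imor_Node)
    have "is_imor (h i) (hl (\<beta> (\<alpha> i))) (i_comp (h i) (gc (\<alpha> i)) (fc i))" if "i \<le> n" for i
      using that f g by (intro Node.IH[OF _ f(3) g(3)]) (auto simp: interval_map_in)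
    then show ?thesis
      using interval_map_compose[OF f(2) g(2)] by (simp add: L f(1) g(1) is_imor_Node compose_eq)
  qed
qed

lemma i_comp_i_id_right: "is_imor H K f \<Longrightarrow> i_comp H f (i_id H) = f"
proof (induction H arbitrary: K f)
  case Triv
  then show ?case using is_imor_from_Triv[OF Triv] by (auto simp: is_imor_To_Triv_iff)
next
  case (Node n h)
  show ?case
  proof (cases K)
    case Triv
    then show ?thesis using Node.prems by (simp add: is_imor_To_Triv_iff)
  next
    case K: (Node m hk)
    with Node.prems obtain \<alpha> gc where f: "f = Mor \<alpha> gc" "interval_map n m \<alpha>"
      "gc \<in> extensional {0..n}" "\<And>i. i \<le> n \<Longrightarrow> is_imor (h i) (hk (\<alpha> i)) (gc i)"
      by (auto simp: is_imor_Node)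
    have "(\<lambda>i\<in>{0..n}. i_comp (h i) (gc i) (i_id (h i))) = gc"
      using f(3,4) Node.IH[OF rangeI] by (intro extensionalityI[of _ "{0..n}"]) auto
    then show ?thesis
      using f by (simp add: interval_map_compose_id cong: restrict_cong)
  qed
qed

lemma i_comp_i_id_left: "is_imor H K f \<Longrightarrow> i_comp H (i_id K) f = f"
proof (induction H arbitrary: K f)
  case Triv
  then show ?case using is_imor_from_Triv[OF Triv] by (auto simp: is_imor_To_Triv_iff)
next
  case (Node n h)
  show ?case
  proof (cases K)
    case Triv
    then show ?thesis using Node.prems by (simp add: is_imor_To_Triv_iff)
  next
    case K: (Node m hk)
    with Node.prems obtain \<alpha> gc where f: "f = Mor \<alpha> gc" "interval_map n m \<alpha>"
      "gc \<in> extensional {0..n}" "\<And>i. i \<le> n \<Longrightarrow> is_imor (h i) (hk (\<alpha> i)) (gc i)"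
      by (auto simp: is_imor_Node)
    have "(\<lambda>i\<in>{0..n}. i_comp (h i) (i_id (hk (\<alpha> i))) (gc i)) = gc"
      using f(3,4) Node.IH[OF rangeI] by (intro extensionalityI[of _ "{0..n}"]) auto
    moreover have "compose {0..n} (\<lambda>i\<in>{0..m}. i) \<alpha> = \<alpha>"
      using f(2) by (rule interval_map_compose_id)
    ultimately show ?thesis
      using f by (simp add: K interval_map_in cong: restrict_cong)
  qed
qed

lemma i_comp_assoc:
  "is_imor H K f \<Longrightarrow> is_imor K L g \<Longrightarrow> is_imor L M e \<Longrightarrow>
     i_comp H (i_comp K e g) f = i_comp H e (i_comp H g f)"
proof (induction H arbitrary: K L M f g e)
  case Triv
  then show ?case by simp
next
  case (Node n h)
  show ?case
  proof (cases M)
    case Triv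
    then show ?thesis using Node.prems by (simp add: is_imor_To_Triv_iff i_comp_To_Triv)
  next
    case M: (Node r hm)
    then obtain l hl where L: "L = Node l hl"
      using Node.prems(3) is_imor_from_Triv by (cases L) auto
    then obtain m hk where K: "K = Node m hk"
      using Node.prems(2) is_imor_from_Triv by (cases K) auto
    obtain \<alpha> fc where f: "f = Mor \<alpha> fc" "interval_map n m \<alpha>"
      "\<And>i. i \<le> n \<Longrightarrow> is_imor (h i) (hk (\<alpha> i)) (fc i)"
      using Node.prems(1) by (auto simp: K is_imor_Node)
    obtain \<beta> gc where g: "g = Mor \<beta> gc" "interval_map m l \<beta>"
      "\<And>i. i \<le> m \<Longrightarrow> is_imor (hk i) (hl (\<beta> i)) (gc i)"
      using Node.prems(2) by (auto simp: K L is_imor_Node)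
    obtain \<gamma> ec where e: "e = Mor \<gamma> ec" "interval_map l r \<gamma>"
      "\<And>i. i \<le> l \<Longrightarrow> is_imor (hl i) (hm (\<gamma> i)) (ec i)"
      using Node.prems(3) by (auto simp: L M is_imor_Node)
    have "i_comp (h i) (i_comp (hk (\<alpha> i)) (ec (\<beta> (\<alpha> i))) (gc (\<alpha> i))) (fc i) =
        i_comp (h i) (ec (\<beta> (\<alpha> i))) (i_comp (h i) (gc (\<alpha> i)) (fc i))" if "i \<le> n" for i
      using that f g e by (intro Node.IH[OF _ f(3) g(3) e(3)]) (auto simp: interval_map_in)
    then show ?thesis
      using f(1,2) g(1,2) e(1)
      by (auto simp: K compose_def interval_map_in fun_eq_iff)
  qed
qed

lemma is_category_iI: "is_category iI"
  unfolding is_category_def iI_def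
  by (auto simp: is_imor_i_id is_imor_i_comp i_comp_i_id_left i_comp_i_id_right i_comp_assoc)


section \<open>Labelled trees and their restrictions\<close>

lemma tobj_tree: "is_tobj T \<Longrightarrow> is_tree T"
  by (simp add: is_tobj_def)

lemma tree_par: "is_tree T \<Longrightarrow> y \<in> lev T (Suc n) \<Longrightarrow> par T n y \<in> lev T n"
  unfolding is_tree_def by blast

lemma lev_0: "is_tree T \<Longrightarrow> lev T 0 = {tree_root T}"
  by (auto simp: is_tree_def tree_root_def)

lemma tobj_bij:
  "is_tobj T \<Longrightarrow> bij_betw (\<lambda>x. (par T n x, pos T n x))
     (lev T (Suc n)) (SIGMA y:lev T n. {0..lab T n y})"
  by (simp add: is_tobj_def)

lemma tobj_pos_le: "is_tobj T \<Longrightarrow> y \<in> lev T (Suc n) \<Longrightarrow> pos T n y \<le> lab T n (par T n y)"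
  using bij_betwE[OF tobj_bij[of T n]] by fastforce

lemma tobj_cropped:
  "is_tobj T \<Longrightarrow> x \<in> lev T (Suc n) \<Longrightarrow>
     lab T (Suc n) x = 0 \<longleftrightarrow> is_endpoint (lab T n (par T n x)) (pos T n x)"
  by (auto simp: is_tobj_def cropped_def)

text \<open>
  A node has as many children as its label has points. If all labels from level \<open>k\<close> on are $[0]$,
  then each node there has exactly one child, so the parent maps are bijections.
\<close>

lemma has_degree_if_labels_0:
  assumes T: "is_tree T"
    and bij: "\<And>n. bij_betw (\<lambda>x. (par T n x, pos T n x))
      (lev T (Suc n)) (SIGMA y:lev T n. {0..lab T n y})"
    and lab: "\<And>n x. n \<ge> k \<Longrightarrow> x \<in> lev T n \<Longrightarrow> lab T n x = 0"
  shows "has_degree T k"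
proof -
  have par: "bij_betw (par T n) (lev T (Suc n)) (lev T n)" if "n \<ge> k" for n
  proof -
    have "(SIGMA y:lev T n. {0..lab T n y}) = lev T n \<times> {0}"
      using lab[OF that] by auto
    with bij[of n]
    have "bij_betw (\<lambda>x. (par T n x, pos T n x)) (lev T (Suc n)) (lev T n \<times> {0})"
      by simp
    from bij_betw_trans[OF this, of fst "lev T n"] show ?thesis
      by (auto simp: bij_betw_def inj_on_def comp_def)
  qed
  have "bij_betw (anc T k m) (lev T (k + m)) (lev T k)" for m
  proof (induction m)
    case 0
    show ?case by (simp add: bij_betw_def)
  next
    case (Suc m)
    have "bij_betw (anc T k m \<circ> par T (k + m)) (lev T (Suc (k + m))) (lev T k)"
      using par Suc by (rule bij_betw_trans) simp
    then show ?case by (simp add: comp_def)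
  qed
  then show ?thesis by (simp add: has_degree_def)
qed

text \<open>
  The only point of $[0]$ is an endpoint, so cropping propagates the label $[0]$ from a node to its
  children.
\<close>

lemma labels_0_if_root_label_0:
  assumes T: "is_tobj T" and root: "lab T 0 (tree_root T) = 0" and x: "x \<in> lev T n"
  shows "lab T n x = 0"
  using x
proof (induction n arbitrary: x)
  case 0
  then show ?case using root lev_0[OF tobj_tree[OF T]] by simp
next
  case (Suc n)
  then show ?case
    using tobj_cropped[OF T] tobj_pos_le[OF T] tree_par[OF tobj_tree[OF T]] by fastforce
qed

lemma t_trivial_iff:
  assumes T: "is_tobj T"
  shows "t_trivial T \<longleftrightarrow> lab T 0 (tree_root T) = 0"
proof
  assume "t_trivial T"
  then have "bij_betw (anc T 0 1) (lev T (0 + 1)) (lev T 0)"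
    unfolding t_trivial_def has_degree_def by blast
  then have "card (lev T 1) = 1"
    using lev_0[OF tobj_tree[OF T]] by (simp add: bij_betw_same_card)
  moreover have "card (lev T 1) = Suc (lab T 0 (tree_root T))"
    using bij_betw_same_card[OF tobj_bij[OF T, of 0]] lev_0[OF tobj_tree[OF T]] by simp
  ultimately show "lab T 0 (tree_root T) = 0" by simp
next
  assume root: "lab T 0 (tree_root T) = 0"
  show "t_trivial T"
    unfolding t_trivial_def
    by (rule has_degree_if_labels_0)
      (use T labels_0_if_root_label_0[OF T root] in \<open>simp_all add: tobj_tree tobj_bij\<close>)
qed

lemma trivial_lab_0: "is_tobj T \<Longrightarrow> t_trivial T \<Longrightarrow> x \<in> lev T n \<Longrightarrow> lab T n x = 0"
  by (simp add: labels_0_if_root_label_0 t_trivial_iff)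

lemma trivial_lev:
  assumes T: "is_tobj T" "t_trivial T"
  obtains t where "\<And>n. lev T n = {t n}"
proof -
  have "\<exists>t. lev T n = {t}" for n
  proof (induction n)
    case 0
    then show ?case using lev_0[OF tobj_tree[OF T(1)]] by blast
  next
    case (Suc n)
    then obtain t where t: "lev T n = {t}" by blast
    with trivial_lab_0[OF T, of t n] have "(SIGMA y:lev T n. {0..lab T n y}) = {(t, 0)}"
      by auto
    then have "card (lev T (Suc n)) = 1"
      using bij_betw_same_card[OF tobj_bij[OF T(1), of n]] by simp
    then show ?case by (auto simp: card_1_singleton_iff)
  qed
  then show ?thesis using that by metis
qed

lemma pos_bij:
  assumes "is_tobj T"
  shows "bij_betw (pos T 0) (lev T 1) {0..lab T 0 (tree_root T)}"
proof -
  have "(SIGMA y:lev T 0. {0..lab T 0 y}) = {tree_root T} \<times> {0..lab T 0 (tree_root T)}"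
    using lev_0[OF tobj_tree[OF assms]] by auto
  with tobj_bij[OF assms, of 0]
  have "bij_betw (\<lambda>x. (par T 0 x, pos T 0 x)) (lev T 1)
      ({tree_root T} \<times> {0..lab T 0 (tree_root T)})"
    by simp
  from bij_betw_trans[OF this, of snd "{0..lab T 0 (tree_root T)}"] show ?thesis
    by (auto simp: bij_betw_def inj_on_def comp_def)
qed

lemma child_lev:
  assumes "is_tobj T" "i \<le> lab T 0 (tree_root T)"
  shows "child T i \<in> lev T (Suc 0)" "pos T 0 (child T i) = i"
  using pos_bij[OF assms(1)] assms(2)
  by (auto simp: child_def bij_betw_def inv_into_into f_inv_into_f)

lemma child_pos:
  assumes "is_tobj T" "x \<in> lev T (Suc 0)"
  shows "child T (pos T 0 x) = x" "pos T 0 x \<le> lab T 0 (tree_root T)"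
  using pos_bij[OF assms(1)] assms(2)
  by (auto simp: child_def bij_betw_def)

lemma sublev_0: "x \<in> lev T (Suc 0) \<Longrightarrow> sublev T x 0 = {x}"
  by (auto simp: sublev_def)

lemma sublev_Suc:
  "is_tree T \<Longrightarrow> y \<in> sublev T x (Suc m) \<longleftrightarrow>
     y \<in> lev T (Suc (Suc m)) \<and> par T (Suc m) y \<in> sublev T x m"
  by (auto simp: sublev_def tree_par)

lemma sublev_lev: "y \<in> sublev T x m \<Longrightarrow> y \<in> lev T (Suc m)"
  by (simp add: sublev_def)

lemma lev_sublev:
  assumes "is_tree T" "y \<in> lev T (Suc m)"
  shows "anc T (Suc 0) m y \<in> lev T (Suc 0)" "y \<in> sublev T (anc T (Suc 0) m y) m"
  using assms anc_in_lev[of T y "Suc 0" m] by (auto simp: sublev_def)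

lemma restr_simps [simp]:
  "lev (restr T x) = sublev T x"
  "y \<in> sublev T x (Suc m) \<Longrightarrow> par (restr T x) m y = par T (Suc m) y"
  "y \<in> sublev T x m \<Longrightarrow> lab (restr T x) m y = lab T (Suc m) y"
  "y \<in> sublev T x (Suc m) \<Longrightarrow> pos (restr T x) m y = pos T (Suc m) y"
  by (simp_all add: restr_def)

lemma tree_root_restr: "x \<in> lev T (Suc 0) \<Longrightarrow> tree_root (restr T x) = x"
  by (simp add: tree_root_def sublev_0)

text \<open>
  A nontrivial tree has positive degree, so its restriction has a degree, one less. The other
  conditions are inherited because the children of a node over \<open>x\<close> are again over \<open>x\<close>.
\<close>

lemma is_tobj_restr:
  assumes T: "is_tobj T" and nt: "\<not> t_trivial T" and x: "x \<in> lev T (Suc 0)"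
  shows "is_tobj (restr T x)"
proof -
  note tree = tobj_tree[OF T]
  have par: "par T (Suc n) y \<in> sublev T x n" if "y \<in> sublev T x (Suc n)" for n y
    using that tree by (simp add: sublev_Suc)
  have "is_tree (restr T x)"
    using x par by (auto simp: is_tree_def sublev_0) (simp add: restr_def)
  moreover have "\<exists>n. has_degree (restr T x) n"
  proof -
    obtain n where n: "has_degree T n" using T by (auto simp: is_tobj_def)
    with nt obtain k where "n = Suc k" by (cases n) (auto simp: t_trivial_def)
    with n have "has_degree (restr T x) k" by (simp add: has_degree_restr[OF tree])
    then show ?thesis ..
  qed
  moreover have "bij_betw (\<lambda>y. (par (restr T x) n y, pos (restr T x) n y))
      (lev (restr T x) (Suc n)) (SIGMA y:lev (restr T x) n. {0..lab (restr T x) n y})" for n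
  proof -
    let ?f = "\<lambda>y. (par T (Suc n) y, pos T (Suc n) y)"
    let ?S = "SIGMA y:sublev T x n. {0..lab T (Suc n) y}"
    have bij: "bij_betw ?f (lev T (Suc (Suc n))) (SIGMA y:lev T (Suc n). {0..lab T (Suc n) y})"
      by (rule tobj_bij[OF T])
    have "?f ` sublev T x (Suc n) = ?S"
    proof (intro subset_antisym subsetI)
      fix z assume "z \<in> ?f ` sublev T x (Suc n)"
      then show "z \<in> ?S"
        using tobj_pos_le[OF T] par by (auto dest: sublev_lev)
    next
      fix z assume z: "z \<in> ?S"
      then have "z \<in> (SIGMA y:lev T (Suc n). {0..lab T (Suc n) y})"
        by (auto dest: sublev_lev)
      then obtain y where "y \<in> lev T (Suc (Suc n))" "z = ?f y"
        using bij_betw_imp_surj_on[OF bij] by blast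
      then show "z \<in> ?f ` sublev T x (Suc n)"
        using z by (auto simp: sublev_Suc[OF tree])
    qed
    then have "bij_betw ?f (sublev T x (Suc n)) ?S"
      by (rule bij_betw_subset[OF bij, rotated]) (auto dest: sublev_lev)
    moreover have "(SIGMA y:sublev T x n. {0..lab (restr T x) n y}) = ?S"
      by auto
    moreover have "?f y = (par (restr T x) n y, pos (restr T x) n y)"
      if "y \<in> sublev T x (Suc n)" for y
      using that by simp
    ultimately show ?thesis
      using bij_betw_cong[of "sublev T x (Suc n)" ?f] by (metis (no_types, lifting) restr_simps(1))
  qed
  moreover have "cropped (restr T x)"
    using tobj_cropped[OF T] par by (auto simp: cropped_def dest: sublev_lev)
  ultimately show ?thesis
    by (simp add: is_tobj_def) (simp add: restr_def)
qed

text \<open>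
  Cropping at the root is what matches the requirement that the components of an object of \<open>iI\<close> are
  trivial exactly at the endpoints.
\<close>

lemma t_trivial_restr_iff:
  assumes "is_tobj T" "\<not> t_trivial T" "x \<in> lev T (Suc 0)"
  shows "t_trivial (restr T x) \<longleftrightarrow> is_endpoint (lab T 0 (tree_root T)) (pos T 0 x)"
proof -
  have "par T 0 x = tree_root T"
    using tree_par[OF tobj_tree[OF assms(1)] assms(3)] lev_0[OF tobj_tree[OF assms(1)]] by simp
  then show ?thesis
    using assms by (simp add: t_trivial_iff[OF is_tobj_restr] tree_root_restr sublev_0
      tobj_cropped[OF assms(1,3)])
qed

text \<open>
  Induction along restrictions, which is well-founded because restricting lowers the degree of a
  nontrivial tree.
\<close>

lemma tobj_induct [consumes 1, case_names trivial nontrivial]: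
  assumes "is_tobj T"
    and "\<And>T. is_tobj T \<Longrightarrow> t_trivial T \<Longrightarrow> P T"
    and "\<And>T. is_tobj T \<Longrightarrow> \<not> t_trivial T \<Longrightarrow>
      (\<And>x. x \<in> lev T (Suc 0) \<Longrightarrow> P (restr T x)) \<Longrightarrow> P T"
  shows "P T"
  using assms(1)
proof (induction T rule: measure_induct_rule[of min_degree])
  case (less T)
  then show ?case
    using assms(2,3) by (metis is_tobj_restr min_degree_restr)
qed


section \<open>Morphisms of labelled trees\<close>

lemma tmor_lev: "is_tmor S T f \<Longrightarrow> x \<in> lev S n \<Longrightarrow> tmap f n x \<in> lev T n"
  unfolding is_tmor_def is_tree_map_def by blast

lemma tmor_par:
  "is_tmor S T f \<Longrightarrow> x \<in> lev S (Suc n) \<Longrightarrow> par T n (tmap f (Suc n) x) = tmap f n (par S n x)"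
  unfolding is_tmor_def is_tree_map_def by blast

lemma tmor_lmap:
  "is_tmor S T f \<Longrightarrow> x \<in> lev S n \<Longrightarrow>
     interval_map (lab S n x) (lab T n (tmap f n x)) (lmap f n x)"
  unfolding is_tmor_def by blast

lemma tmor_pos:
  "is_tmor S T f \<Longrightarrow> x \<in> lev S (Suc n) \<Longrightarrow>
     pos T n (tmap f (Suc n) x) = lmap f n (par S n x) (pos S n x)"
  unfolding is_tmor_def by blast

lemma tmor_ext:
  assumes "is_tmor S T f"
  shows "tmap f n \<in> extensional (lev S n)" "lmap f n \<in> extensional (lev S n)"
  using assms by (simp_all add: is_tmor_def is_tree_map_def PiE_iff)

text \<open>
  The default values outside the levels agree for all morphisms with the same domain, so only nodes
  have to be compared.
\<close>

lemma tmor_eqI: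
  assumes "is_tmor S T f" "is_tmor S T' g"
    and "\<And>n x. x \<in> lev S n \<Longrightarrow> tmap f n x = tmap g n x"
    and "\<And>n x. x \<in> lev S n \<Longrightarrow> lmap f n x = lmap g n x"
  shows "f = g"
proof -
  have "tmap f n = tmap g n" "lmap f n = lmap g n" for n
    using assms by (auto intro!: extensionalityI[of _ "lev S n"] dest: tmor_ext)
  then show ?thesis by (intro tmor.equality) auto
qed

lemma is_tmor_t_id: "is_tobj S \<Longrightarrow> is_tmor S S (t_id S)"
  by (auto simp: is_tmor_def is_tree_map_def t_id_def interval_map_id tree_par tobj_tree
      tobj_pos_le)

lemma is_tmor_t_comp:
  assumes S: "is_tobj S" and f: "is_tmor S T f" and g: "is_tmor T U g"
  shows "is_tmor S U (t_comp S g f)"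
proof -
  note [simp] = tmor_lev[OF f] tmor_lev[OF g] tmor_par[OF f] tmor_par[OF g]
    tmor_pos[OF f] tmor_pos[OF g] tree_par[OF tobj_tree[OF S]] tobj_pos_le[OF S]
  have [simp]: "compose A v u x = undefined" if "x \<notin> A" for A x and u v :: "'a \<Rightarrow> 'a"
    using that by (simp add: compose_def)
  show ?thesis
    using tmor_lmap[OF f] tmor_lmap[OF g]
    by (auto simp: is_tmor_def is_tree_map_def t_comp_def compose_eq
        intro!: interval_map_compose)
qed

lemma is_category_tI: "is_category (tI :: ('a ltree, 'a tmor) category)"
  unfolding is_category_def tI_def category.simps mem_Collect_eq
proof (intro conjI ballI)
  fix S T :: "'a ltree" and f assume "S \<in> {T. is_tobj T}" "T \<in> {T. is_tobj T}" "f \<in> {f. is_tmor S T f}"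
  then have S: "is_tobj S" and T: "is_tobj T" and f: "is_tmor S T f" by auto
  have comp: "is_tmor S T (t_comp S f (t_id S))" "is_tmor S T (t_comp S (t_id T) f)"
    using S T f by (auto intro: is_tmor_t_comp is_tmor_t_id)
  note lmap = interval_map_compose_id[OF tmor_lmap[OF f]]
  show "t_comp S f (t_id S) = f"
    by (rule tmor_eqI[OF comp(1) f])
      (auto simp: t_comp_def t_id_def compose_eq lmap)
  show "t_comp S (t_id T) f = f"
    by (rule tmor_eqI[OF comp(2) f])
      (auto simp: t_comp_def t_id_def compose_eq lmap tmor_lev[OF f])
next
  fix S T U V :: "'a ltree" and f g h
  assume "S \<in> {T. is_tobj T}" "T \<in> {T. is_tobj T}" "f \<in> {f. is_tmor S T f}"
    "g \<in> {f. is_tmor T U f}" "h \<in> {f. is_tmor U V f}"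
  then have S: "is_tobj S" and T: "is_tobj T"
    and f: "is_tmor S T f" and g: "is_tmor T U g" and h: "is_tmor U V h" by auto
  have comp: "is_tmor S V (t_comp S (t_comp T h g) f)" "is_tmor S V (t_comp S h (t_comp S g f))"
    using S T f g h by (blast intro: is_tmor_t_comp)+
  show "t_comp S (t_comp T h g) f = t_comp S h (t_comp S g f)"
    by (rule tmor_eqI[OF comp])
      (auto simp: t_comp_def compose_eq tmor_lev[OF f] tmor_lev[OF g] compose_def fun_eq_iff
        dest: interval_map_in[OF tmor_lmap[OF f]])
qed (auto intro: is_tmor_t_comp is_tmor_t_id)

lemma anc_tmap:
  "is_tree S \<Longrightarrow> is_tmor S T f \<Longrightarrow> y \<in> lev S (n + m) \<Longrightarrow>
     anc T n m (tmap f (n + m) y) = tmap f n (anc S n m y)"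
  by (induction m arbitrary: y) (simp_all add: tmor_par tree_par)

lemma tmap_sublev:
  assumes "is_tree S" "is_tmor S T f" "y \<in> sublev S x m"
  shows "tmap f (Suc m) y \<in> sublev T (tmap f (Suc 0) x) m"
  using assms anc_tmap[OF assms(1,2), of y "Suc 0" m] by (auto simp: sublev_def tmor_lev)

lemma is_tmor_restr_mor:
  assumes S: "is_tree S" and f: "is_tmor S T f"
  shows "is_tmor (restr S x) (restr T (tmap f (Suc 0) x)) (restr_mor S f x)"
  unfolding is_tmor_def is_tree_map_def
  using tmap_sublev[OF S f] sublev_lev[of _ S x] sublev_Suc[OF S, of _ x]
  by (auto simp: restr_mor_def tmor_par[OF f] tmor_pos[OF f] tmor_lmap[OF f])

lemma restr_mor_t_id: "is_tree S \<Longrightarrow> restr_mor S (t_id S) x = t_id (restr S x)"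
  by (auto simp: restr_mor_def t_id_def fun_eq_iff restrict_def sublev_lev)

lemma restr_mor_t_comp:
  assumes "is_tree S" "is_tmor S T f"
  shows "restr_mor S (t_comp S g f) x =
    t_comp (restr S x) (restr_mor T g (tmap f (Suc 0) x)) (restr_mor S f x)"
  using tmap_sublev[OF assms]
  by (auto simp: restr_mor_def t_comp_def fun_eq_iff restrict_def sublev_lev compose_def)


section \<open>The functor\<close>

lemma Xi_obj_trivial: "is_tobj T \<Longrightarrow> t_trivial T \<Longrightarrow> Xi_obj T = Triv"
  by (simp add: Xi_obj.simps)

lemma Xi_obj_nontrivial:
  "is_tobj T \<Longrightarrow> \<not> t_trivial T \<Longrightarrow> Xi_obj T =
     Node (lab T 0 (tree_root T))
       (\<lambda>i\<in>{0..lab T 0 (tree_root T)}. Xi_obj (restr T (child T i)))"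
  by (simp add: Xi_obj.simps[of T])

lemma Xi_obj_Triv_iff: "is_tobj T \<Longrightarrow> Xi_obj T = Triv \<longleftrightarrow> t_trivial T"
  by (auto simp: Xi_obj.simps[of T])

lemma Xi_mor_trivial:
  "is_tobj S \<Longrightarrow> is_tobj T \<Longrightarrow> is_tmor S T f \<Longrightarrow> t_trivial T \<Longrightarrow> Xi_mor S T f = To_Triv"
  by (simp add: Xi_mor.simps)

lemma Xi_mor_nontrivial:
  "is_tobj S \<Longrightarrow> is_tobj T \<Longrightarrow> is_tmor S T f \<Longrightarrow> \<not> t_trivial T \<Longrightarrow>
     Xi_mor S T f = Mor (lmap f 0 (tree_root S))
       (\<lambda>i\<in>{0..lab S 0 (tree_root S)}. Xi_mor (restr S (child S i))
          (restr T (tmap f (Suc 0) (child S i))) (restr_mor S f (child S i)))"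
  by (subst Xi_mor.simps) (auto simp: Let_def fun_eq_iff)

lemma iobject_Xi_obj: "is_tobj T \<Longrightarrow> iobject (Xi_obj T)"
proof (induction T rule: tobj_induct)
  case (trivial T)
  then show ?case by (simp add: Xi_obj_trivial)
next
  case (nontrivial T)
  have "Xi_obj (restr T (child T i)) = Triv \<longleftrightarrow> is_endpoint (lab T 0 (tree_root T)) i"
    if "i \<le> lab T 0 (tree_root T)" for i
    using that nontrivial.hyps
    by (simp add: Xi_obj_Triv_iff is_tobj_restr t_trivial_restr_iff child_lev)
  then show ?case
    using nontrivial by (simp add: Xi_obj_nontrivial iobject_Node child_lev t_trivial_iff)
qed

lemma tmor_root:
  assumes "is_tobj S" "is_tobj T" "is_tmor S T f"
  shows "tmap f 0 (tree_root S) = tree_root T"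
    and "interval_map (lab S 0 (tree_root S)) (lab T 0 (tree_root T)) (lmap f 0 (tree_root S))"
proof -
  show *: "tmap f 0 (tree_root S) = tree_root T"
    using tmor_lev[OF assms(3), of "tree_root S" 0] assms by (simp add: lev_0 tobj_tree)
  show "interval_map (lab S 0 (tree_root S)) (lab T 0 (tree_root T)) (lmap f 0 (tree_root S))"
    using tmor_lmap[OF assms(3), of "tree_root S" 0] assms by (simp add: lev_0 tobj_tree *)
qed

text \<open>
  A map out of $[0]$ preserving both endpoints has to identify the endpoints of its codomain.
\<close>

lemma tmor_nontrivial:
  "is_tobj S \<Longrightarrow> is_tobj T \<Longrightarrow> is_tmor S T f \<Longrightarrow> \<not> t_trivial T \<Longrightarrow> \<not> t_trivial S"
  using tmor_root(2)[of S T f] no_interval_map_0 by (metis t_trivial_iff)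

lemma par_0: "is_tobj T \<Longrightarrow> x \<in> lev T (Suc 0) \<Longrightarrow> par T 0 x = tree_root T"
  using tree_par[of T x 0] lev_0[of T] by (simp add: tobj_tree)

text \<open>
  A node of level 1 is determined by its position, so the tree map in level 1 is determined by the
  interval map at the root. This is why the restrictions of a morphism have the codomains that a
  morphism of \<open>iI\<close> with the same object map requires.
\<close>

lemma tmap_1:
  assumes "is_tobj S" "is_tobj T" "is_tmor S T f" "x \<in> lev S (Suc 0)"
  shows "tmap f (Suc 0) x = child T (lmap f 0 (tree_root S) (pos S 0 x))"
  using assms child_pos(1)[OF assms(2), of "tmap f (Suc 0) x"]
  by (simp add: tmor_lev tmor_pos[OF assms(3)] par_0)

lemma tmap_child:
  assumes "is_tobj S" "is_tobj T" "is_tmor S T f" "i \<le> lab S 0 (tree_root S)"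
  shows "tmap f (Suc 0) (child S i) = child T (lmap f 0 (tree_root S) i)"
  using assms by (simp add: tmap_1[OF assms(1-3)] child_lev)

lemma is_imor_Xi_mor:
  "is_tobj T \<Longrightarrow> is_tobj S \<Longrightarrow> is_tmor S T f \<Longrightarrow> is_imor (Xi_obj S) (Xi_obj T) (Xi_mor S T f)"
proof (induction T arbitrary: S f rule: tobj_induct)
  case (trivial T)
  then show ?case by (simp add: Xi_obj_trivial Xi_mor_trivial is_imor_To_Triv_iff)
next
  case (nontrivial T)
  note S = \<open>is_tobj S\<close> and T = \<open>is_tobj T\<close> and f = \<open>is_tmor S T f\<close>
  have nt: "\<not> t_trivial S" using tmor_nontrivial S T f nontrivial.hyps by blast
  have "is_imor (Xi_obj (restr S (child S i))) (Xi_obj (restr T (child T (lmap f 0 (tree_root S) i))))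
      (Xi_mor (restr S (child S i)) (restr T (tmap f (Suc 0) (child S i))) (restr_mor S f (child S i)))"
    if i: "i \<le> lab S 0 (tree_root S)" for i
    using nontrivial.IH[OF tmor_lev[OF f child_lev(1)[OF S i]]
        is_tobj_restr[OF S nt child_lev(1)[OF S i]] is_tmor_restr_mor[OF tobj_tree[OF S] f]]
    by (simp add: tmap_child[OF S T f i])
  then show ?case
    using S T f nt nontrivial.hyps tmor_root(2)[OF S T f]
    by (simp add: Xi_obj_nontrivial Xi_mor_nontrivial is_imor_Node interval_map_in)
qed

lemma Xi_mor_t_id: "is_tobj S \<Longrightarrow> Xi_mor S S (t_id S) = i_id (Xi_obj S)"
proof (induction S rule: tobj_induct)
  case (trivial S)
  then show ?case by (simp add: Xi_obj_trivial Xi_mor_trivial is_tmor_t_id tobj_tree)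
next
  case (nontrivial S)
  have "tmap (t_id S) (Suc 0) (child S i) = child S i" if "i \<le> lab S 0 (tree_root S)" for i
    using child_lev(1)[OF nontrivial.hyps(1) that] by (simp add: t_id_def)
  moreover have "lmap (t_id S) 0 (tree_root S) = (\<lambda>i\<in>{0..lab S 0 (tree_root S)}. i)"
    using lev_0[OF tobj_tree[OF nontrivial.hyps(1)]] by (simp add: t_id_def)
  ultimately show ?case
    using nontrivial
    by (simp add: Xi_obj_nontrivial Xi_mor_nontrivial is_tmor_t_id tobj_tree restr_mor_t_id
        child_lev cong: restrict_cong)
qed

lemma Xi_mor_t_comp:
  "is_tobj U \<Longrightarrow> is_tobj S \<Longrightarrow> is_tobj T \<Longrightarrow> is_tmor S T f \<Longrightarrow> is_tmor T U g \<Longrightarrow>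
     Xi_mor S U (t_comp S g f) = i_comp (Xi_obj S) (Xi_mor T U g) (Xi_mor S T f)"
proof (induction U arbitrary: S T f g rule: tobj_induct)
  case (trivial U)
  then show ?case by (simp add: Xi_mor_trivial[of _ U] is_tmor_t_comp i_comp_To_Triv)
next
  case (nontrivial U)
  note S = \<open>is_tobj S\<close> and T = \<open>is_tobj T\<close> and U = \<open>is_tobj U\<close>
    and f = \<open>is_tmor S T f\<close> and g = \<open>is_tmor T U g\<close>
  have gf: "is_tmor S U (t_comp S g f)" using S f g by (rule is_tmor_t_comp)
  have ntT: "\<not> t_trivial T" using tmor_nontrivial T U g nontrivial.hyps by blast
  have ntS: "\<not> t_trivial S" using tmor_nontrivial S T f ntT by blast
  have root: "tree_root S \<in> lev S 0" using lev_0[OF tobj_tree[OF S]] by simp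
  have "Xi_mor (restr S (child S i)) (restr U (tmap (t_comp S g f) (Suc 0) (child S i)))
        (restr_mor S (t_comp S g f) (child S i)) =
      i_comp (Xi_obj (restr S (child S i)))
        (Xi_mor (restr T (child T (lmap f 0 (tree_root S) i)))
          (restr U (tmap g (Suc 0) (child T (lmap f 0 (tree_root S) i))))
          (restr_mor T g (child T (lmap f 0 (tree_root S) i))))
        (Xi_mor (restr S (child S i)) (restr T (tmap f (Suc 0) (child S i)))
          (restr_mor S f (child S i)))"
    if i: "i \<le> lab S 0 (tree_root S)" for i
  proof -
    let ?x = "child S i" and ?y = "tmap f (Suc 0) (child S i)"
    have x: "?x \<in> lev S (Suc 0)" using S i by (rule child_lev)
    then have y: "?y \<in> lev T (Suc 0)" by (rule tmor_lev[OF f])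
    have "tmap (t_comp S g f) (Suc 0) ?x = tmap g (Suc 0) ?y"
      using x by (simp add: t_comp_def compose_eq)
    then show ?thesis
      using nontrivial.IH[OF tmor_lev[OF g y] is_tobj_restr[OF S ntS x] is_tobj_restr[OF T ntT y]
          is_tmor_restr_mor[OF tobj_tree[OF S] f] is_tmor_restr_mor[OF tobj_tree[OF T] g]]
      by (simp add: restr_mor_t_comp[OF tobj_tree[OF S] f] tmap_child[OF S T f i])
  qed
  moreover have "lmap (t_comp S g f) 0 (tree_root S) =
      compose {0..lab S 0 (tree_root S)} (lmap g 0 (tree_root T)) (lmap f 0 (tree_root S))"
    using root by (simp add: t_comp_def tmor_root(1)[OF S T f])
  ultimately show ?case
    using S T U f g gf ntS ntT nontrivial.hyps tmor_root(2)[OF S T f]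
    by (simp add: Xi_obj_nontrivial Xi_mor_nontrivial interval_map_in cong: restrict_cong)
qed

lemma is_functor_Xi: "is_functor (tI :: ('a ltree, 'a tmor) category) iI Xi"
  using is_category_tI is_category_iI
  by (auto simp: is_functor_def Xi_def iobject_Xi_obj is_imor_Xi_mor Xi_mor_t_id Xi_mor_t_comp
      simp: tI_def iI_def)


section \<open>Full faithfulness\<close>

text \<open>
  Into a nontrivial tree, equal values force equal root maps, hence equal tree maps in level 1. The
  restrictions of the two morphisms at a node then have the same codomain, so the induction
  hypothesis applies to them.
\<close>

lemma Xi_mor_inj:
  "is_tobj T \<Longrightarrow> is_tobj S \<Longrightarrow> is_tmor S T f \<Longrightarrow> is_tmor S T f' \<Longrightarrow>
     Xi_mor S T f = Xi_mor S T f' \<Longrightarrow> f = f'"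
proof (induction T arbitrary: S f f' rule: tobj_induct)
  case (trivial T)
  note S = \<open>is_tobj S\<close> and T = \<open>is_tobj T\<close> and f = \<open>is_tmor S T f\<close> and f' = \<open>is_tmor S T f'\<close>
  obtain t where t: "\<And>n. lev T n = {t n}" using trivial_lev T trivial.hyps by blast
  show ?case
  proof (rule tmor_eqI[OF f f'])
    fix n x assume x: "x \<in> lev S n"
    show "tmap f n x = tmap f' n x" using tmor_lev[OF f x] tmor_lev[OF f' x] t by simp
    show "lmap f n x = lmap f' n x"
      using tmor_lmap[OF f x] tmor_lmap[OF f' x] trivial_lab_0[OF T trivial.hyps(2)]
        tmor_lev[OF f x] tmor_lev[OF f' x]
      by (simp add: interval_map_to_0)
  qed
next
  case (nontrivial T)
  note S = \<open>is_tobj S\<close> and T = \<open>is_tobj T\<close> and f = \<open>is_tmor S T f\<close> and f' = \<open>is_tmor S T f'\<close>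
  have nt: "\<not> t_trivial S" using tmor_nontrivial S T f nontrivial.hyps by blast
  have lmap: "lmap f 0 (tree_root S) = lmap f' 0 (tree_root S)"
    using nontrivial.prems nontrivial.hyps by (simp add: Xi_mor_nontrivial)
  have restr: "restr_mor S f x = restr_mor S f' x" if x: "x \<in> lev S (Suc 0)" for x
  proof (rule nontrivial.IH[OF tmor_lev[OF f x] is_tobj_restr[OF S nt x]])
    have tmap: "tmap f (Suc 0) x = tmap f' (Suc 0) x"
      using x by (simp add: tmap_1[OF S T f] tmap_1[OF S T f'] lmap)
    show "is_tmor (restr S x) (restr T (tmap f (Suc 0) x)) (restr_mor S f x)"
      using S f by (simp add: is_tmor_restr_mor tobj_tree)
    show "is_tmor (restr S x) (restr T (tmap f (Suc 0) x)) (restr_mor S f' x)"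
      using S f' by (simp add: is_tmor_restr_mor tobj_tree tmap)
    have "Xi_mor (restr S (child S (pos S 0 x))) (restr T (tmap f (Suc 0) (child S (pos S 0 x))))
        (restr_mor S f (child S (pos S 0 x))) =
      Xi_mor (restr S (child S (pos S 0 x))) (restr T (tmap f' (Suc 0) (child S (pos S 0 x))))
        (restr_mor S f' (child S (pos S 0 x)))"
      using nontrivial.prems nontrivial.hyps child_pos(2)[OF S x]
      by (auto simp: Xi_mor_nontrivial dest!: fun_cong[of _ _ "pos S 0 x"])
    then show "Xi_mor (restr S x) (restr T (tmap f (Suc 0) x)) (restr_mor S f x) =
        Xi_mor (restr S x) (restr T (tmap f (Suc 0) x)) (restr_mor S f' x)"
      by (simp add: child_pos(1)[OF S x] tmap)
  qed
  show ?case
  proof (rule tmor_eqI[OF f f'])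
    fix n x assume x: "x \<in> lev S n"
    show "tmap f n x = tmap f' n x" "lmap f n x = lmap f' n x"
    proof (atomize(full), cases n)
      case 0
      then show "tmap f n x = tmap f' n x \<and> lmap f n x = lmap f' n x"
        using x lmap tmor_root(1)[OF S T f] tmor_root(1)[OF S T f'] lev_0[OF tobj_tree[OF S]]
        by simp
    next
      case (Suc m)
      let ?y = "anc S (Suc 0) m x"
      have y: "?y \<in> lev S (Suc 0)" "x \<in> sublev S ?y m"
        using lev_sublev[OF tobj_tree[OF S]] x Suc by auto
      have "tmap (restr_mor S f ?y) m x = tmap (restr_mor S f' ?y) m x"
        "lmap (restr_mor S f ?y) m x = lmap (restr_mor S f' ?y) m x"
        using restr[OF y(1)] by simp_all
      then show "tmap f n x = tmap f' n x \<and> lmap f n x = lmap f' n x"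
        using y(2) Suc by (simp add: restr_mor_def)
    qed
  qed
qed

text \<open>
  The morphism with interval map \<open>\<alpha>\<close> at the root and restriction \<open>g x\<close> at each node \<open>x\<close> of
  level 1.
\<close>

definition graft ::
  "'a ltree \<Rightarrow> 'a ltree \<Rightarrow> (nat \<Rightarrow> nat) \<Rightarrow> ('a \<Rightarrow> 'a tmor) \<Rightarrow> 'a tmor" where
  "graft S T \<alpha> g =
     \<lparr>tmap = (\<lambda>n. \<lambda>y\<in>lev S n.
        case n of 0 \<Rightarrow> tree_root T | Suc m \<Rightarrow> tmap (g (anc S (Suc 0) m y)) m y),
      lmap = (\<lambda>n. \<lambda>y\<in>lev S n.
        case n of 0 \<Rightarrow> \<alpha> | Suc m \<Rightarrow> lmap (g (anc S (Suc 0) m y)) m y)\<rparr>"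

text \<open>
  Above level 1, a node and its parent lie over the same node \<open>x\<close>, so the conditions on a morphism
  are those for \<open>g x\<close>. Between levels 0 and 1 they hold because \<open>g x\<close> ends in the restriction at the
  child whose position is prescribed by \<open>\<alpha>\<close>.
\<close>

lemma is_tmor_graft:
  assumes S: "is_tobj S" and T: "is_tobj T"
    and \<alpha>: "interval_map (lab S 0 (tree_root S)) (lab T 0 (tree_root T)) \<alpha>"
    and g: "\<And>x. x \<in> lev S (Suc 0) \<Longrightarrow> is_tmor (restr S x) (restr T (child T (\<alpha> (pos S 0 x)))) (g x)"
  shows "is_tmor S T (graft S T \<alpha> g)"
    and "\<And>x. x \<in> lev S (Suc 0) \<Longrightarrow> restr_mor S (graft S T \<alpha> g) x = g x"
proof -
  note tree = tobj_tree[OF S] tobj_tree[OF T]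
  \<comment> \<open>the node of level 1 to which \<open>x\<close> has to be sent\<close>
  define c where "c x = child T (\<alpha> (pos S 0 x))" for x
  have c: "c x \<in> lev T (Suc 0)" "pos T 0 (c x) = \<alpha> (pos S 0 x)" if "x \<in> lev S (Suc 0)" for x
    using child_lev[OF T interval_map_in[OF \<alpha> child_pos(2)[OF S that]]] by (simp_all add: c_def)
  have g: "is_tmor (restr S x) (restr T (c x)) (g x)" if "x \<in> lev S (Suc 0)" for x
    using g[OF that] by (simp add: c_def)
  have on_sub: "tmap (graft S T \<alpha> g) (Suc m) y = tmap (g x) m y"
    "lmap (graft S T \<alpha> g) (Suc m) y = lmap (g x) m y" if "y \<in> sublev S x m" for x y m
    using that by (simp_all add: graft_def sublev_def)
  have at_root: "tmap (graft S T \<alpha> g) 0 (tree_root S) = tree_root T"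
    "lmap (graft S T \<alpha> g) 0 (tree_root S) = \<alpha>"
    using lev_0[OF tree(1)] by (simp_all add: graft_def)
  have ext: "tmap (graft S T \<alpha> g) n \<in> extensional (lev S n)"
    "lmap (graft S T \<alpha> g) n \<in> extensional (lev S n)" for n
    by (simp_all add: graft_def)
  have level: "tmap (graft S T \<alpha> g) n y \<in> lev T n \<and>
      interval_map (lab S n y) (lab T n (tmap (graft S T \<alpha> g) n y)) (lmap (graft S T \<alpha> g) n y)"
    if y: "y \<in> lev S n" for n y
  proof (cases n)
    case 0
    then show ?thesis
      using y \<alpha> by (simp add: lev_0[OF tree(1)] lev_0[OF tree(2)] at_root)
  next
    case (Suc m)
    let ?x = "anc S (Suc 0) m y"
    have x: "?x \<in> lev S (Suc 0)" "y \<in> sublev S ?x m"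
      using lev_sublev[OF tree(1)] y Suc by auto
    have "tmap (g ?x) m y \<in> sublev T (c ?x) m"
      using tmor_lev[OF g[OF x(1)], of y m] x(2) by simp
    then show ?thesis
      using tmor_lmap[OF g[OF x(1)], of y m] x(2) by (simp add: Suc on_sub[OF x(2)] sublev_lev)
  qed
  have step: "par T n (tmap (graft S T \<alpha> g) (Suc n) y) = tmap (graft S T \<alpha> g) n (par S n y) \<and>
      pos T n (tmap (graft S T \<alpha> g) (Suc n) y) = lmap (graft S T \<alpha> g) n (par S n y) (pos S n y)"
    if y: "y \<in> lev S (Suc n)" for n y
  proof (cases n)
    case 0
    have "tmap (g y) 0 y \<in> sublev T (c y) 0"
      using tmor_lev[OF g, of y y 0] y 0 by (simp add: sublev_0)
    then have "tmap (graft S T \<alpha> g) (Suc 0) y = c y"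
      using on_sub(1)[of y y 0] y 0 c(1)[of y] by (simp add: sublev_0)
    then show ?thesis
      using y 0 by (simp add: at_root par_0[OF S] par_0[OF T] c)
  next
    case (Suc m)
    let ?x = "anc S (Suc 0) n y"
    have x: "?x \<in> lev S (Suc 0)" "y \<in> sublev S ?x (Suc m)"
      using lev_sublev[OF tree(1), of y n] y Suc by auto
    have px: "par S (Suc m) y \<in> sublev S ?x m"
      using x(2) by (simp add: sublev_Suc[OF tree(1)])
    have "tmap (g ?x) (Suc m) y \<in> sublev T (c ?x) (Suc m)"
      using tmor_lev[OF g[OF x(1)], of y "Suc m"] x(2) by simp
    then show ?thesis
      using tmor_par[OF g[OF x(1)], of y m] tmor_pos[OF g[OF x(1)], of y m] x(2)
      by (simp add: Suc on_sub[OF x(2)] on_sub[OF px])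
  qed
  show "is_tmor S T (graft S T \<alpha> g)"
    using level step ext by (simp add: is_tmor_def is_tree_map_def PiE_iff)
  show "restr_mor S (graft S T \<alpha> g) x = g x" if "x \<in> lev S (Suc 0)" for x
  proof -
    have "tmap (restr_mor S (graft S T \<alpha> g) x) n = tmap (g x) n" for n
      using tmor_ext(1)[OF g[OF that], of n] on_sub
      by (intro extensionalityI[of _ "sublev S x n"]) (auto simp: restr_mor_def)
    moreover have "lmap (restr_mor S (graft S T \<alpha> g) x) n = lmap (g x) n" for n
      using tmor_ext(2)[OF g[OF that], of n] on_sub
      by (intro extensionalityI[of _ "sublev S x n"]) (auto simp: restr_mor_def)
    ultimately show ?thesis by (intro tmor.equality) auto
  qed
qed

text \<open>
  In the inductive step the components of the given morphism are lifted to the restrictions, and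
  the lifts are grafted together.
\<close>

lemma Xi_mor_surj:
  "is_tobj T \<Longrightarrow> is_tobj S \<Longrightarrow> is_imor (Xi_obj S) (Xi_obj T) k \<Longrightarrow>
     \<exists>f. is_tmor S T f \<and> Xi_mor S T f = k"
proof (induction T arbitrary: S k rule: tobj_induct)
  case (trivial T)
  note S = \<open>is_tobj S\<close> and T = \<open>is_tobj T\<close>
  obtain t where t: "\<And>n. lev T n = {t n}" using trivial_lev T trivial.hyps by blast
  \<comment> \<open>the only map of each level into a singleton, and the only interval map into $[0]$\<close>
  define f where "f = \<lparr>tmap = (\<lambda>n. \<lambda>x\<in>lev S n. t n),
    lmap = (\<lambda>n. \<lambda>x\<in>lev S n. \<lambda>i\<in>{0..lab S n x}. 0)\<rparr>"
  have "is_tmor S T f"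
    unfolding is_tmor_def is_tree_map_def
  proof (intro conjI allI ballI)
    fix n x assume x: "x \<in> lev S (Suc n)"
    note px = tree_par[OF tobj_tree[OF S] x]
    have pt: "par T n (t (Suc n)) = t n" "pos T n (t (Suc n)) = 0"
      using tree_par[OF tobj_tree[OF T], of "t (Suc n)" n] tobj_pos_le[OF T, of "t (Suc n)" n]
        trivial_lab_0[OF T trivial.hyps(2)] t by auto
    show "par T n (tmap f (Suc n) x) = tmap f n (par S n x)"
      using x px pt by (simp add: f_def)
    show "pos T n (tmap f (Suc n) x) = lmap f n (par S n x) (pos S n x)"
      using x px pt tobj_pos_le[OF S x] by (simp add: f_def)
  qed (auto simp: f_def t trivial_lab_0[OF T trivial.hyps(2)] interval_map_to_0)
  then show ?case
    using trivial by (auto simp: Xi_obj_trivial Xi_mor_trivial is_imor_To_Triv_iff)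
next
  case (nontrivial T)
  note S = \<open>is_tobj S\<close> and T = \<open>is_tobj T\<close>
  have ntS: "\<not> t_trivial S"
    using nontrivial.prems nontrivial.hyps is_imor_from_Triv
    by (auto simp flip: Xi_obj_Triv_iff)
  from nontrivial.prems(2) obtain \<alpha> kc where k: "k = Mor \<alpha> kc"
      and \<alpha>: "interval_map (lab S 0 (tree_root S)) (lab T 0 (tree_root T)) \<alpha>"
      and ext: "kc \<in> extensional {0..lab S 0 (tree_root S)}"
      and kc: "\<And>i. i \<le> lab S 0 (tree_root S) \<Longrightarrow>
        is_imor (Xi_obj (restr S (child S i))) (Xi_obj (restr T (child T (\<alpha> i)))) (kc i)"
    using S T ntS nontrivial.hyps
    by (auto simp: Xi_obj_nontrivial is_imor_Node interval_map_in)
  have "\<exists>f. is_tmor (restr S x) (restr T (child T (\<alpha> (pos S 0 x)))) f \<and>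
      Xi_mor (restr S x) (restr T (child T (\<alpha> (pos S 0 x)))) f = kc (pos S 0 x)"
    if x: "x \<in> lev S (Suc 0)" for x
    using kc[OF child_pos(2)[OF S x]] x
    by (intro nontrivial.IH child_lev[OF T] is_tobj_restr[OF S ntS] interval_map_in[OF \<alpha>])
      (simp_all add: child_pos[OF S x])
  then obtain g where
    g: "\<And>x. x \<in> lev S (Suc 0) \<Longrightarrow> is_tmor (restr S x) (restr T (child T (\<alpha> (pos S 0 x)))) (g x)"
    and Xi_g: "\<And>x. x \<in> lev S (Suc 0) \<Longrightarrow>
      Xi_mor (restr S x) (restr T (child T (\<alpha> (pos S 0 x)))) (g x) = kc (pos S 0 x)"
    by metis
  let ?f = "graft S T \<alpha> g"
  note f = is_tmor_graft[OF S T \<alpha> g]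
  have lmap: "lmap ?f 0 (tree_root S) = \<alpha>"
    using lev_0[OF tobj_tree[OF S]] by (simp add: graft_def)
  have "Xi_mor (restr S (child S i)) (restr T (tmap ?f (Suc 0) (child S i)))
      (restr_mor S ?f (child S i)) = kc i" if i: "i \<le> lab S 0 (tree_root S)" for i
    using Xi_g[OF child_lev(1)[OF S i]] child_lev[OF S i]
    by (simp add: tmap_child[OF S T f(1) i] lmap f(2))
  then have "(\<lambda>i\<in>{0..lab S 0 (tree_root S)}. Xi_mor (restr S (child S i))
      (restr T (tmap ?f (Suc 0) (child S i))) (restr_mor S ?f (child S i))) = kc"
    using ext by (intro extensionalityI[of _ "{0..lab S 0 (tree_root S)}"]) auto
  then have "Xi_mor S T ?f = k"
    using S T f(1) nontrivial.hyps by (simp add: Xi_mor_nontrivial lmap k)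
  with f(1) show ?case by blast
qed

lemma Xi_fully_faithful:
  assumes "is_tobj S" "is_tobj T"
  shows "bij_betw (Xi_mor S T) {f. is_tmor S T f} {k. is_imor (Xi_obj S) (Xi_obj T) k}"
  unfolding bij_betw_def
proof
  show "inj_on (Xi_mor S T) {f. is_tmor S T f}"
    using Xi_mor_inj[OF assms(2,1)] by (auto intro: inj_onI)
  show "Xi_mor S T ` {f. is_tmor S T f} = {k. is_imor (Xi_obj S) (Xi_obj T) k}"
    using Xi_mor_surj[OF assms(2,1)] is_imor_Xi_mor[OF assms(2,1)] by force
qed


section \<open>Surjectivity on objects\<close>

primrec width :: "iobj \<Rightarrow> nat" where
  "width Triv = 0"
| "width (Node n h) = n"

primrec component :: "iobj \<Rightarrow> nat \<Rightarrow> iobj" where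
  "component Triv i = Triv"
| "component (Node n h) i = h i"

text \<open>
  The paths that can be followed into \<open>H\<close>. A path \<open>p\<close> leads to the object \<open>foldl component H p\<close>;
  once this is trivial, the path can only be continued by \<open>0\<close>.
\<close>

primrec address :: "iobj \<Rightarrow> nat list \<Rightarrow> bool" where
  "address H [] \<longleftrightarrow> True"
| "address H (i # p) \<longleftrightarrow> i \<le> width H \<and> address (component H i) p"

lemma address_snoc:
  "address H (p @ [i]) \<longleftrightarrow> address H p \<and> i \<le> width (foldl component H p)"
  by (induction p arbitrary: H) auto

lemma iobject_component: "iobject H \<Longrightarrow> i \<le> width H \<Longrightarrow> iobject (component H i)"
  by (cases H) (auto simp: iobject_Node simp del: ex_simps)

lemma iobject_at: "iobject H \<Longrightarrow> address H p \<Longrightarrow> iobject (foldl component H p)"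
  by (induction p arbitrary: H) (use iobject_component in auto)

lemma width_component:
  "iobject H \<Longrightarrow> i \<le> width H \<Longrightarrow> width (component H i) = 0 \<longleftrightarrow> is_endpoint (width H) i"
proof (cases H)
  case (Node n h)
  assume "iobject H" "i \<le> width H"
  moreover have "width K = 0 \<longleftrightarrow> K = Triv" if "iobject K" for K
    using that by (cases K) (auto simp: iobject_Node simp del: ex_simps)
  ultimately show ?thesis
    by (auto simp: Node iobject_Node simp del: ex_simps)
qed auto

text \<open>
  Each step out of a nontrivial object lowers the height, so long paths end in \<open>Triv\<close>. This is what
  gives the tree of paths a finite degree.
\<close>

lemma Triv_beyond_height:
  "has_height k H \<Longrightarrow> address H p \<Longrightarrow> k \<le> length p \<Longrightarrow> foldl component H p = Triv"
proof (induction k H arbitrary: p rule: has_height.induct)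
  case Triv
  show ?case by (induction p) auto
next
  case (Node k n h)
  then obtain i q where p: "p = i # q" "i \<le> n" "address (h i) q" by (cases p) auto
  then obtain j where "j < k"
    "\<And>q. address (h i) q \<Longrightarrow> j \<le> length q \<Longrightarrow> foldl component (h i) q = Triv"
    using Node.IH by (meson atLeastAtMost_iff le0)
  then show ?case using p Node.prems by simp
qed

text \<open>
  The tree of paths into \<open>H\<close>, where \<open>e\<close> names the node reached by a path. The parent of a node
  forgets the last step of its path, and the position of a node is that step. The naming is a
  parameter because it changes on passing to a restriction.
\<close>

definition path_tree :: "(nat list \<Rightarrow> 'a) \<Rightarrow> iobj \<Rightarrow> 'a ltree" where
  "path_tree e H = (let L = (\<lambda>n. e ` {p. length p = n \<and> address H p}) in
     \<lparr>lev = L,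
      par = (\<lambda>n. \<lambda>y\<in>L (Suc n). e (butlast (inv e y))),
      lab = (\<lambda>n. \<lambda>y\<in>L n. width (foldl component H (inv e y))),
      pos = (\<lambda>n. \<lambda>y\<in>L (Suc n). last (inv e y))\<rparr>)"

lemma path_tree_simps [simp]:
  "lev (path_tree e H) n = e ` {p. length p = n \<and> address H p}"
  "inj e \<Longrightarrow> address H p \<Longrightarrow> length p = n \<Longrightarrow>
     lab (path_tree e H) n (e p) = width (foldl component H p)"
  "inj e \<Longrightarrow> address H (p @ [i]) \<Longrightarrow> length p = n \<Longrightarrow> par (path_tree e H) n (e (p @ [i])) = e p"
  "inj e \<Longrightarrow> address H (p @ [i]) \<Longrightarrow> length p = n \<Longrightarrow> pos (path_tree e H) n (e (p @ [i])) = i"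
  by (auto simp: path_tree_def Let_def)

lemma path_tree_lev_Suc:
  "y \<in> lev (path_tree e H) (Suc n) \<longleftrightarrow>
     (\<exists>p i. y = e (p @ [i]) \<and> length p = n \<and> address H (p @ [i]))"
  by (auto simp: length_Suc_conv_rev)

lemma is_tobj_path_tree:
  assumes e: "inj e" and H: "iobject H"
  shows "is_tobj (path_tree e H)"
proof -
  let ?T = "path_tree e H"
  have tree: "is_tree ?T"
    unfolding is_tree_def
  proof (intro conjI allI)
    show "\<exists>r. lev ?T 0 = {r}" by (auto intro!: exI[of _ "e []"])
    fix n
    have "par ?T n \<in> extensional (lev ?T (Suc n))"
      by (simp add: path_tree_def Let_def)
    moreover have "par ?T n y \<in> lev ?T n" if "y \<in> lev ?T (Suc n)" for y
      using that e unfolding path_tree_lev_Suc by (auto simp: address_snoc)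
    ultimately show "par ?T n \<in> lev ?T (Suc n) \<rightarrow>\<^sub>E lev ?T n"
      by (auto simp: PiE_iff)
  qed
  have bij: "bij_betw (\<lambda>x. (par ?T n x, pos ?T n x)) (lev ?T (Suc n))
      (SIGMA y:lev ?T n. {0..lab ?T n y})" for n
    unfolding bij_betw_def
  proof
    show "inj_on (\<lambda>x. (par ?T n x, pos ?T n x)) (lev ?T (Suc n))"
    proof (rule inj_onI)
      fix x y assume "x \<in> lev ?T (Suc n)" "y \<in> lev ?T (Suc n)"
        "(par ?T n x, pos ?T n x) = (par ?T n y, pos ?T n y)"
      then show "x = y" using e unfolding path_tree_lev_Suc by (auto dest: injD)
    qed
    show "(\<lambda>x. (par ?T n x, pos ?T n x)) ` lev ?T (Suc n) = (SIGMA y:lev ?T n. {0..lab ?T n y})"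
    proof (intro subset_antisym subsetI)
      fix z assume "z \<in> (\<lambda>x. (par ?T n x, pos ?T n x)) ` lev ?T (Suc n)"
      then obtain y where "y \<in> lev ?T (Suc n)" "z = (par ?T n y, pos ?T n y)" by blast
      then show "z \<in> (SIGMA y:lev ?T n. {0..lab ?T n y})"
        using e unfolding path_tree_lev_Suc by (auto simp: address_snoc)
    next
      fix z assume "z \<in> (SIGMA y:lev ?T n. {0..lab ?T n y})"
      then obtain p i where p: "z = (e p, i)" "length p = n" "address H (p @ [i])"
        using e by (auto simp: address_snoc)
      then have "e (p @ [i]) \<in> lev ?T (Suc n)" by auto
      moreover have "z = (par ?T n (e (p @ [i])), pos ?T n (e (p @ [i])))"
        using p e by simp
      ultimately show "z \<in> (\<lambda>x. (par ?T n x, pos ?T n x)) ` lev ?T (Suc n)" by blast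
    qed
  qed
  have "has_degree ?T k" if "has_height k H" for k
    using tree bij
  proof (rule has_degree_if_labels_0)
    fix n x assume "n \<ge> k" "x \<in> lev ?T n"
    then show "lab ?T n x = 0"
      using e Triv_beyond_height[OF that] by auto
  qed
  moreover have "cropped ?T"
    unfolding cropped_def
  proof (intro allI ballI)
    fix n x assume "x \<in> lev ?T (Suc n)"
    then obtain p i where p: "x = e (p @ [i])" "length p = n" "address H (p @ [i])"
      unfolding path_tree_lev_Suc by blast
    then have "address H p" "i \<le> width (foldl component H p)" by (auto simp: address_snoc)
    then show "is_endpoint (lab ?T n (par ?T n x)) (pos ?T n x) \<longleftrightarrow> lab ?T (Suc n) x = 0"
      using p e width_component[OF iobject_at[OF H]] by simp
  qed
  moreover have "lab ?T n \<in> extensional (lev ?T n)" "pos ?T n \<in> extensional (lev ?T (Suc n))" for n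
    by (simp_all add: path_tree_def Let_def)
  ultimately show ?thesis
    using tree bij H unfolding is_tobj_def by blast
qed

lemma tree_root_path_tree: "tree_root (path_tree e H) = e []"
proof -
  have "{p. length p = 0 \<and> address H p} = {[]}" by auto
  then show ?thesis by (simp add: tree_root_def)
qed

lemma child_path_tree:
  assumes "inj e" "iobject H" "i \<le> width H"
  shows "child (path_tree e H) i = e [i]"
proof -
  have "e [i] \<in> lev (path_tree e H) (Suc 0)" using assms(3) by auto
  from child_pos(1)[OF is_tobj_path_tree[OF assms(1,2)] this] show ?thesis
    using path_tree_simps(4)[OF assms(1), of H "[]" i 0] assms(3) by simp
qed

lemma sublev_path_tree:
  assumes e: "inj e"
  shows "sublev (path_tree e H) (e [i]) m =
    (if i \<le> width H then lev (path_tree (e \<circ> Cons i) (component H i)) m else {})"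
proof -
  have anc: "anc (path_tree e H) (Suc 0) m (e (j # p)) = e [j]"
    if "length p = m" "address H (j # p)" for j p
    using that
  proof (induction m arbitrary: p)
    case (Suc m)
    then obtain q k where q: "p = q @ [k]" "length q = m" by (auto simp: length_Suc_conv_rev)
    have "address H (j # q)" using Suc.prems q address_snoc[of H "j # q" k] by simp
    then show ?case
      using Suc.IH[of q] Suc.prems q path_tree_simps(3)[OF e, of H "j # q" k "Suc m"] by simp
  qed simp
  show ?thesis
  proof (intro subset_antisym subsetI)
    fix y assume y: "y \<in> sublev (path_tree e H) (e [i]) m"
    then obtain j p where p: "y = e (j # p)" "length p = m" "address H (j # p)"
      by (auto simp: sublev_def length_Suc_conv)
    with y anc have "j = i" using e by (auto simp: sublev_def dest: injD)
    with p show "y \<in> (if i \<le> width H then lev (path_tree (e \<circ> Cons i) (component H i)) m else {})"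
      by auto
  next
    fix y assume "y \<in> (if i \<le> width H then lev (path_tree (e \<circ> Cons i) (component H i)) m else {})"
    then obtain p where "y = e (i # p)" "length p = m" "address H (i # p)"
      by (auto split: if_splits)
    with anc show "y \<in> sublev (path_tree e H) (e [i]) m"
      by (auto simp: sublev_def)
  qed
qed

text \<open>
  The paths through \<open>i\<close> are the paths into the component at \<open>i\<close>, preceded by \<open>i\<close>. Changing the
  naming accordingly makes this an equality of labelled trees and not just an isomorphism, so that
  the induction in the next lemma applies.
\<close>

lemma restr_path_tree:
  assumes e: "inj e" and i: "i \<le> width H"
  shows "restr (path_tree e H) (e [i]) = path_tree (e \<circ> Cons i) (component H i)"
    (is "restr ?T ?x = ?U")
proof -
  have ei: "inj (e \<circ> Cons i)" using e by (auto intro!: injI dest: injD)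
  have lev: "sublev ?T ?x m = lev ?U m" for m
    using sublev_path_tree[OF e] i by simp
  have ext: "par ?U m \<in> extensional (lev ?U (Suc m))" "lab ?U m \<in> extensional (lev ?U m)"
    "pos ?U m \<in> extensional (lev ?U (Suc m))" for m
    by (simp_all add: path_tree_def Let_def)
  have step: "par ?T (Suc m) y = par ?U m y \<and> pos ?T (Suc m) y = pos ?U m y"
    if y: "y \<in> lev ?U (Suc m)" for m y
  proof -
    obtain p j where p: "y = (e \<circ> Cons i) (p @ [j])" "length p = m" "address (component H i) (p @ [j])"
      using y unfolding path_tree_lev_Suc by blast
    then show ?thesis
      using path_tree_simps(3,4)[OF e, of H "i # p" j "Suc m"]
        path_tree_simps(3,4)[OF ei p(3,2)] i by simp
  qed
  have "lab ?T (Suc m) y = lab ?U m y" if y: "y \<in> lev ?U m" for m y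
  proof -
    obtain p where p: "y = (e \<circ> Cons i) p" "length p = m" "address (component H i) p"
      using y by auto
    then show ?thesis
      using path_tree_simps(2)[OF e, of H "i # p" "Suc m"] path_tree_simps(2)[OF ei p(3,2)] i
      by simp
  qed
  then have "restrict (lab ?T (Suc m)) (lev ?U m) = lab ?U m" for m
    using ext by (intro extensionalityI[of _ "lev ?U m"]) auto
  moreover have "restrict (par ?T (Suc m)) (lev ?U (Suc m)) = par ?U m"
    "restrict (pos ?T (Suc m)) (lev ?U (Suc m)) = pos ?U m" for m
    using ext step by (auto intro!: extensionalityI[of _ "lev ?U (Suc m)"])
  ultimately show ?thesis
    unfolding restr_def lev by (intro ltree.equality) (auto simp del: path_tree_simps simp: lev)
qed

lemma Xi_obj_path_tree: "inj e \<Longrightarrow> iobject H \<Longrightarrow> Xi_obj (path_tree e H) = H"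
proof (induction H arbitrary: e)
  case Triv
  then have T: "is_tobj (path_tree e Triv)" by (rule is_tobj_path_tree)
  have "lab (path_tree e Triv) 0 (e []) = 0" using Triv by simp
  then show ?case
    by (intro Xi_obj_trivial T) (simp add: t_trivial_iff[OF T] tree_root_path_tree)
next
  case (Node n h)
  let ?T = "path_tree e (Node n h)"
  have h: "n \<ge> 1" "h \<in> extensional {0..n}" "\<And>i. i \<le> n \<Longrightarrow> iobject (h i)"
    using Node.prems(2) unfolding iobject_Node by auto
  have T: "is_tobj ?T" using Node.prems by (rule is_tobj_path_tree)
  have lab: "lab ?T 0 (tree_root ?T) = n" using Node.prems by (simp add: tree_root_path_tree)
  have "Xi_obj (restr ?T (child ?T i)) = h i" if i: "i \<le> n" for i
  proof -
    have "Xi_obj (path_tree (e \<circ> Cons i) (h i)) = h i"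
      using Node.prems(1) h(3)[OF i] by (intro Node.IH) (auto intro!: injI dest: injD)
    then show ?thesis
      using child_path_tree[OF Node.prems, of i] restr_path_tree[OF Node.prems(1), of i "Node n h"] i
      by simp
  qed
  then have "(\<lambda>i\<in>{0..n}. Xi_obj (restr ?T (child ?T i))) = h"
    using h(2) by (intro extensionalityI[of _ "{0..n}"]) auto
  then show ?case
    using Xi_obj_nontrivial[OF T] h(1) by (simp add: t_trivial_iff[OF T] lab)
qed

text \<open>
  An infinite type has room for names of all finite paths.
\<close>

lemma Xi_surjective_on_objects:
  "surjective_on_objects (tI :: ('a::infinite ltree, 'a tmor) category) iI Xi"
proof -
  obtain \<iota> :: "nat \<Rightarrow> 'a" where "inj \<iota>"
    using infinite_countable_subset[OF infinite_UNIV] by blast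
  then have "inj (\<iota> \<circ> (to_nat :: nat list \<Rightarrow> nat))"
    by (intro inj_compose inj_to_nat)
  then show ?thesis
    using is_tobj_path_tree Xi_obj_path_tree
    by (fastforce simp: surjective_on_objects_def tI_def iI_def Xi_def)
qed

theorem proposition8p3:
  shows "is_equivalence (tI :: ('a::infinite ltree, 'a tmor) category) iI Xi \<and>
         surjective_on_objects (tI :: ('a ltree, 'a tmor) category) iI Xi"
proof
  show "is_equivalence (tI :: ('a ltree, 'a tmor) category) iI Xi"
  proof (rule equivalenceI[OF is_functor_Xi])
    fix S T :: "'a ltree"
    assume "S \<in> Obj tI" "T \<in> Obj tI"
    then show "bij_betw (on_hom Xi S T) (Hom tI S T) (Hom iI (on_obj Xi S) (on_obj Xi T))"
      using Xi_fully_faithful by (simp add: tI_def iI_def Xi_def)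
  qed (rule Xi_surjective_on_objects)
qed (rule Xi_surjective_on_objects)

end
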